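(* The variety $\mathbf{P}_3$ of $3$-dimensional complex Poisson algebras has exactly six irreducible components, namely $\overline{O(\mathcal{P}_{3,5})}$, $\overline{O(\mathcal{P}_{3,7})}$, $\overline{O(\mathcal{P}_{3,18})}$, $\overline{O(\mathcal{P}_{3,20})}$, $\overline{\bigcup_{\alpha\in\mathbb{C}}O(\mathcal{P}_{3,4}^{\alpha})}$ and $\overline{\bigcup_{\alpha\in\mathbb{C}}O(\mathcal{P}_{3,16}^{\alpha})}$, where (basis $e_1,e_2,e_3$, only nonzero products listed up to commutativity of $\cdot$ and anticommutativity of $\{-,-\}$): $\mathcal{P}_{3,4}^{\alpha}$: $\{e_1,e_2\}=e_2,\{e_1,e_3\}=\alpha e_3$; $\mathcal{P}_{3,5}$: $\{e_1,e_2\}=e_3,\{e_1,e_3\}=-2e_1,\{e_2,e_3\}=2e_2$; $\mathcal{P}_{3,7}$: $e_1\cdot e_1=e_1,e_2\cdot e_2=e_2,e_3\cdot e_3=e_3$; $\mathcal{P}_{3,16}^{\alpha}$: $e_1\cdot e_2=e_3,\{e_1,e_2\}=\alpha e_3$; $\mathcal{P}_{3,18}$: $e_1\cdot e_1=e_1,e_1\cdot e_2=e_2,e_1\cdot e_3=e_3,\{e_2,e_3\}=e_2$; $\mathcal{P}_{3,20}$: $e_1\cdot e_1=e_1,\{e_2,e_3\}=e_2$.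
   Context: A Poisson algebra has a commutative associative product $\cdot$ and a Lie bracket $\{-,-\}$ with $\{x\cdot y,z\}=\{x,z\}\cdot y+x\cdot\{y,z\}$. Fix a $3$-dimensional complex vector space $V$; pairs $(\mu,\mu')$ of bilinear maps on $V$ are identified with their structure constants in $\mathbb{C}^{54}$, and $\mathbf{P}_3$ is the affine variety of pairs defining Poisson algebras. $\mathrm{GL}(V)$ acts by $(g*(\mu,\mu'))(x,y)=(g\mu(g^{-1}x,g^{-1}y),g\mu'(g^{-1}x,g^{-1}y))$, and $O(\mathcal{P})$ is the orbit of a structure representing $\mathcal{P}$. Closures are Zariski closures. *)

theory Defs
  imports "HOL-Analysis.Analysis"
begin

text \<open>V = complex^3 with standard basis e_1, e_2, e_3 given by the indices 0, 1, 2 :: 3.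
A pair (mu, mu') of bilinear maps is given by its 54 structure constants, a point
c :: bool \<times> 3 \<times> 3 \<times> 3 \<Rightarrow> complex:
c (False,i,j,k) is the e_k-coefficient of mu(e_i,e_j) (the product),
c (True,i,j,k) is the e_k-coefficient of mu'(e_i,e_j) (the bracket).\<close>

type_synonym pt = "bool \<times> 3 \<times> 3 \<times> 3 \<Rightarrow> complex"

definition bil :: "bool \<Rightarrow> pt \<Rightarrow> complex^3 \<Rightarrow> complex^3 \<Rightarrow> complex^3" where
  "bil b c x y = (\<chi> k. \<Sum>i\<in>UNIV. \<Sum>j\<in>UNIV. x$i * y$j * c (b,i,j,k))"

abbreviation mul :: "pt \<Rightarrow> complex^3 \<Rightarrow> complex^3 \<Rightarrow> complex^3" where
  "mul c \<equiv> bil False c"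
abbreviation br :: "pt \<Rightarrow> complex^3 \<Rightarrow> complex^3 \<Rightarrow> complex^3" where
  "br c \<equiv> bil True c"

definition is_poisson :: "pt \<Rightarrow> bool" where
  "is_poisson c \<longleftrightarrow>
     (\<forall>x y. mul c x y = mul c y x) \<and>
     (\<forall>x y z. mul c (mul c x y) z = mul c x (mul c y z)) \<and>
     (\<forall>x. br c x x = 0) \<and>
     (\<forall>x y z. br c x (br c y z) + br c y (br c z x) + br c z (br c x y) = 0) \<and>
     (\<forall>x y z. br c (mul c x y) z = mul c (br c x z) y + mul c x (br c y z))"

definition P3 :: "pt set" where
  "P3 = {c. is_poisson c}"

definition orbit :: "pt \<Rightarrow> pt set" where
  "orbit c = {c'. \<exists>g :: complex^3^3. invertible g \<and>
      (\<forall>b x y. bil b c' x y = g *v bil b c (matrix_inv g *v x) (matrix_inv g *v y))}"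

inductive_set poly_fun :: "(('i \<Rightarrow> complex) \<Rightarrow> complex) set" where
  const: "(\<lambda>_. a) \<in> poly_fun"
| coord: "(\<lambda>x. x i) \<in> poly_fun"
| add: "f \<in> poly_fun \<Longrightarrow> g \<in> poly_fun \<Longrightarrow> (\<lambda>x. f x + g x) \<in> poly_fun"
| mult: "f \<in> poly_fun \<Longrightarrow> g \<in> poly_fun \<Longrightarrow> (\<lambda>x. f x * g x) \<in> poly_fun"

definition zclosed :: "('i \<Rightarrow> complex) set \<Rightarrow> bool" where
  "zclosed S \<longleftrightarrow> (\<exists>F \<subseteq> poly_fun. S = {x. \<forall>f\<in>F. f x = 0})"

definition zclosure :: "('i \<Rightarrow> complex) set \<Rightarrow> ('i \<Rightarrow> complex) set" where
  "zclosure S = \<Inter> {C. zclosed C \<and> S \<subseteq> C}"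

definition zirreducible :: "('i \<Rightarrow> complex) set \<Rightarrow> bool" where
  "zirreducible C \<longleftrightarrow> C \<noteq> {} \<and>
     (\<forall>A B. zclosed A \<and> zclosed B \<and> C \<subseteq> A \<union> B \<longrightarrow> C \<subseteq> A \<or> C \<subseteq> B)"

definition irreducible_components :: "('i \<Rightarrow> complex) set \<Rightarrow> ('i \<Rightarrow> complex) set set" where
  "irreducible_components S = {C. C \<subseteq> S \<and> zclosed C \<and> zirreducible C \<and>
     (\<forall>D. D \<subseteq> S \<and> zclosed D \<and> zirreducible D \<and> C \<subseteq> D \<longrightarrow> D = C)}"

text \<open>Building structure constants from multiplication tables.
 symtab: entries (i,j,k,v) meaning e_i . e_j = v e_k (and e_j . e_i = v e_k).
 asymtab: entries (i,j,k,v) meaning {e_i,e_j} = v e_k (and {e_j,e_i} = -v e_k), i \<noteq> j.\<close>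
definition symtab :: "(3 \<times> 3 \<times> 3 \<times> complex) list \<Rightarrow> 3 \<Rightarrow> 3 \<Rightarrow> 3 \<Rightarrow> complex" where
  "symtab xs i j k = sum_list (map (\<lambda>(a,b,c,v).
      if c = k \<and> ((a,b) = (i,j) \<or> (a,b) = (j,i)) then v else 0) xs)"

definition asymtab :: "(3 \<times> 3 \<times> 3 \<times> complex) list \<Rightarrow> 3 \<Rightarrow> 3 \<Rightarrow> 3 \<Rightarrow> complex" where
  "asymtab xs i j k = sum_list (map (\<lambda>(a,b,c,v).
      (if c = k \<and> (a,b) = (i,j) then v else 0) - (if c = k \<and> (a,b) = (j,i) then v else 0)) xs)"

definition mkstr :: "(3 \<times> 3 \<times> 3 \<times> complex) list \<Rightarrow> (3 \<times> 3 \<times> 3 \<times> complex) list \<Rightarrow> pt" where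
  "mkstr M B = (\<lambda>(b,i,j,k). if b then asymtab B i j k else symtab M i j k)"

text \<open>e_1 = index 0, e_2 = index 1, e_3 = index 2.\<close>
definition P3_4 :: "complex \<Rightarrow> pt" where
  "P3_4 \<alpha> = mkstr [] [(0,1,1,1), (0,2,2,\<alpha>)]"
definition P3_5 :: pt where
  "P3_5 = mkstr [] [(0,1,2,1), (0,2,0,-2), (1,2,1,2)]"
definition P3_7 :: pt where
  "P3_7 = mkstr [(0,0,0,1), (1,1,1,1), (2,2,2,1)] []"
definition P3_16 :: "complex \<Rightarrow> pt" where
  "P3_16 \<alpha> = mkstr [(0,1,2,1)] [(0,1,2,\<alpha>)]"
definition P3_18 :: pt where
  "P3_18 = mkstr [(0,0,0,1), (0,1,1,1), (0,2,2,1)] [(1,2,1,1)]"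
definition P3_20 :: pt where
  "P3_20 = mkstr [(0,0,0,1)] [(1,2,1,1)]"

end

theory Submission
  imports Defs "HOL-Computational_Algebra.Fundamental_Theorem_Algebra"
begin

text \<open>
The variety is the union of the six closures, each of which is irreducible, and none of which
contains another; this determines the irreducible components without any appeal to noetherianity.

Covering. If the product vanishes, the bracket is a symmetric matrix together with the covector
\<open>tr ad\<close>: either the covector is zero, and a generic symmetric matrix gives \<open>sl_2\<close>, or the Jacobi
identity forces a two-dimensional abelian ideal on which the rest acts by one matrix, generically
diagonalisable. If the product does not vanish and some \<open>x, x\<^sup>2, x\<^sup>3\<close> are independent, the bracket is
zero and perturbing the minimal polynomial of \<open>x\<close> gives three copies of the field. Otherwise either
there is an idempotent, which is central and splits the algebra, or the algebra is nilpotent; in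
both cases the non-existence of a generator leaves only a few explicit tables.

Separation. Each closure satisfies polynomial identities invariant under base change (vanishing of
certain products or traces, rank one conditions) that fail at some point of every other family.
\<close>

section \<open>Zariski closed sets and curves\<close>

text \<open>Neither orbit dimensions nor a list of isomorphism classes is used. The closure of a
  base-change stable set is stable, so an algebra may be replaced by its table in any convenient
  basis; a special table is then the value at 0 of a polynomial curve that lies in the closure for
  all but finitely many parameters. The absence of a generator is so restrictive because of one
  computation. Let \<open>e\<close> be an idempotent that is a unit or annihilates \<open>y\<close>.
  If \<open>y y\<close> is not in the span of \<open>e\<close> and \<open>y\<close>, the determinant
  of the first three powers of \<open>l e + y\<close> is a nonzero cubic in \<open>l\<close>, so
  some \<open>l\<close> gives a generator. Hence every such \<open>y\<close> obeys a quadratic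
  relation, and polarisation with associativity determines the product. In \<open>P3_18\<close> each
  multiplication operator is a scalar plus a nilpotent of rank at most one, so the rank one test for
  it must be applied to traceless parts.\<close>

lemma poly_fun_sum:
  assumes "\<And>a. a \<in> A \<Longrightarrow> f a \<in> poly_fun"
  shows "(\<lambda>x. \<Sum>a\<in>A. f a x) \<in> poly_fun"
  using assms
proof (induction A rule: infinite_finite_induct)
  case (insert a A)
  then show ?case by (simp add: poly_fun.add)
qed (simp_all add: poly_fun.const)

lemma poly_fun_uminus: "f \<in> poly_fun \<Longrightarrow> (\<lambda>x. - f x) \<in> poly_fun"
  using poly_fun.mult[OF poly_fun.const[of "-1"], of f] by simp

lemma poly_fun_diff: "f \<in> poly_fun \<Longrightarrow> g \<in> poly_fun \<Longrightarrow> (\<lambda>x. f x - g x) \<in> poly_fun"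
  using poly_fun.add[OF _ poly_fun_uminus, of f g] by simp

lemma poly_fun_compose:
  assumes "f \<in> poly_fun" "\<And>i. (\<lambda>x. \<phi> x i) \<in> poly_fun"
  shows "(\<lambda>x. f (\<phi> x)) \<in> poly_fun"
  using assms(1) by induction (auto intro: poly_fun.intros assms(2))

text \<open>The closure is cut out by all polynomials vanishing on the set, a family that contains
  the equations of every closed superset.\<close>

lemma zclosed_zclosure: "zclosed (zclosure S)"
proof -
  let ?F = "{f \<in> poly_fun. \<forall>x\<in>S. f x = 0}"
  have "zclosure S = {x. \<forall>f\<in>?F. f x = 0}"
  proof
    have "zclosed {x. \<forall>f\<in>?F. f x = 0}"
      unfolding zclosed_def by (intro exI[of _ ?F]) auto
    then show "zclosure S \<subseteq> {x. \<forall>f\<in>?F. f x = 0}"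
      unfolding zclosure_def by blast
    show "{x. \<forall>f\<in>?F. f x = 0} \<subseteq> zclosure S"
      unfolding zclosure_def zclosed_def by blast
  qed
  then show ?thesis
    unfolding zclosed_def by (intro exI[of _ ?F]) auto
qed

lemma zclosure_subset: "S \<subseteq> zclosure S"
  unfolding zclosure_def by blast

lemma zclosure_minimal: "S \<subseteq> C \<Longrightarrow> zclosed C \<Longrightarrow> zclosure S \<subseteq> C"
  unfolding zclosure_def by blast

lemma zclosed_INT:
  assumes "\<And>a. a \<in> A \<Longrightarrow> zclosed (S a)"
  shows "zclosed (\<Inter>a\<in>A. S a)"
proof -
  have "\<forall>a\<in>A. \<exists>G. G \<subseteq> poly_fun \<and> S a = {x. \<forall>f\<in>G. f x = 0}"
    using assms unfolding zclosed_def by simp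
  from bchoice[OF this] obtain F
    where F0: "\<forall>a\<in>A. F a \<subseteq> poly_fun \<and> S a = {x. \<forall>f\<in>F a. f x = 0}" ..
  have F: "F a \<subseteq> poly_fun" "S a = {x. \<forall>f\<in>F a. f x = 0}" if "a \<in> A" for a
    using bspec[OF F0 that] by (rule conjunct1, rule conjunct2)
  have "(\<Inter>a\<in>A. S a) = {x. \<forall>f\<in>(\<Union>a\<in>A. F a). f x = 0}"
  proof (rule set_eqI)
    fix x
    have "x \<in> S a \<longleftrightarrow> (\<forall>f\<in>F a. f x = 0)" if "a \<in> A" for a
      unfolding F(2)[OF that] by (rule mem_Collect_eq)
    then show "x \<in> (\<Inter>a\<in>A. S a) \<longleftrightarrow> x \<in> {x. \<forall>f\<in>(\<Union>a\<in>A. F a). f x = 0}"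
      unfolding mem_Collect_eq by blast
  qed
  moreover have "(\<Union>a\<in>A. F a) \<subseteq> poly_fun"
    using F(1) by (rule UN_least)
  ultimately show ?thesis
    unfolding zclosed_def by blast
qed

lemma zclosed_Collect_all: "(\<And>a. zclosed {c. Q a c}) \<Longrightarrow> zclosed {c. \<forall>a. Q a c}"
  using zclosed_INT[of UNIV "\<lambda>a. {c. Q a c}"] by (simp add: Collect_all_eq)

lemma zclosed_Collect_conj:
  assumes "zclosed {c. Q c}" "zclosed {c. R c}"
  shows "zclosed {c. Q c \<and> R c}"
proof -
  have "{c. Q c \<and> R c} = (\<Inter>b. if b then {c. Q c} else {c. R c})" by (auto split: if_splits)
  then show ?thesis using zclosed_INT[of UNIV "\<lambda>b. if b then {c. Q c} else {c. R c}"] assms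
    by (metis (full_types))
qed

lemma zclosed_Collect_eq:
  assumes "f \<in> poly_fun" "g \<in> poly_fun"
  shows "zclosed {c. f c = g c}"
  unfolding zclosed_def
  by (intro exI[of _ "{\<lambda>c. f c - g c}"]) (auto intro: poly_fun_diff assms)

lemma zclosed_vimage:
  assumes "zclosed C" "\<And>i. (\<lambda>x. \<phi> x i) \<in> poly_fun"
  shows "zclosed {x. \<phi> x \<in> C}"
proof -
  obtain F where F: "F \<subseteq> poly_fun" "C = {x. \<forall>f\<in>F. f x = 0}"
    using assms(1) unfolding zclosed_def by blast
  show ?thesis
    unfolding zclosed_def F(2)
    by (intro exI[of _ "(\<lambda>f x. f (\<phi> x)) ` F"]) (use F(1) assms(2) poly_fun_compose in \<open>auto\<close>)
qed

lemma zclosed_empty: "zclosed {}"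
  unfolding zclosed_def by (intro exI[of _ "{\<lambda>_. 1}"]) (simp add: poly_fun.const)

lemma zclosed_Un:
  assumes "zclosed A" "zclosed B"
  shows "zclosed (A \<union> B)"
proof -
  obtain FA where FA: "FA \<subseteq> poly_fun" "A = {x. \<forall>f\<in>FA. f x = 0}"
    using assms(1) unfolding zclosed_def by blast
  obtain FB where FB: "FB \<subseteq> poly_fun" "B = {x. \<forall>f\<in>FB. f x = 0}"
    using assms(2) unfolding zclosed_def by blast
  let ?H = "(\<lambda>(f,g) x. f x * g x) ` (FA \<times> FB)"
  have "x \<in> A \<union> B \<longleftrightarrow> (\<forall>h\<in>?H. h x = 0)" for x
  proof -
    have "x \<in> A \<union> B \<longleftrightarrow> (\<forall>f\<in>FA. f x = 0) \<or> (\<forall>g\<in>FB. g x = 0)"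
      unfolding FA(2) FB(2) Un_iff mem_Collect_eq ..
    also have "\<dots> \<longleftrightarrow> (\<forall>f\<in>FA. \<forall>g\<in>FB. f x * g x = 0)"
      unfolding mult_eq_0_iff by blast
    also have "\<dots> \<longleftrightarrow> (\<forall>h\<in>?H. h x = 0)"
      unfolding ball_simps(9) by (auto simp only: split_paired_Ball_Sigma prod.case)
    finally show ?thesis .
  qed
  then have "A \<union> B = {x. \<forall>h\<in>?H. h x = 0}" by blast
  moreover have "?H \<subseteq> poly_fun" using FA(1) FB(1) by (auto intro!: poly_fun.mult)
  ultimately show ?thesis unfolding zclosed_def by blast
qed

text \<open>An irreducible set covered by finitely many closed sets lies in one of them, so a
  maximal one equals a member of \<open>F\<close>; incomparability makes each member
  maximal.\<close>

lemma irreducible_components_eq: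
  assumes fin: "finite F"
    and closed: "\<And>C. C \<in> F \<Longrightarrow> zclosed C"
    and irr: "\<And>C. C \<in> F \<Longrightarrow> zirreducible C"
    and union: "\<Union>F = S"
    and incomparable: "\<And>C D. C \<in> F \<Longrightarrow> D \<in> F \<Longrightarrow> C \<subseteq> D \<Longrightarrow> C = D"
  shows "irreducible_components S = F"
proof -
  have cover: "\<exists>C\<in>G. D \<subseteq> C" if "finite G" "G \<subseteq> F" "D \<subseteq> \<Union>G" "zirreducible D" for D G
    using that
  proof (induction G rule: finite_induct)
    case empty
    then show ?case by (auto simp: zirreducible_def)
  next
    case (insert C G)
    have "zclosed (\<Union>G)" if "G \<subseteq> F" for G
    proof -
      have "finite G" using that fin finite_subset by blast
      then show ?thesis using that
        by (induction G rule: finite_induct) (simp_all add: zclosed_empty zclosed_Un closed)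
    qed
    then have "D \<subseteq> C \<or> D \<subseteq> \<Union>G"
      using insert.prems closed unfolding zirreducible_def by (metis Union_insert insert_subset)
    then show ?case using insert by blast
  qed
  show ?thesis
  proof (intro equalityI subsetI)
    fix D assume "D \<in> irreducible_components S"
    then have D: "D \<subseteq> S" "zirreducible D"
      "\<And>E. E \<subseteq> S \<Longrightarrow> zclosed E \<Longrightarrow> zirreducible E \<Longrightarrow> D \<subseteq> E \<Longrightarrow> E = D"
      unfolding irreducible_components_def by auto
    obtain C where C: "C \<in> F" "D \<subseteq> C"
      using cover[OF fin subset_refl _ D(2)] D(1) unfolding union by blast
    have "C \<subseteq> S" using C(1) unfolding union[symmetric] by (rule Union_upper)
    then show "D \<in> F" using D(3)[of C] C closed irr by simp
  next
    fix C assume C: "C \<in> F"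
    have "D = C" if D: "D \<subseteq> S" "zirreducible D" "C \<subseteq> D" for D
    proof -
      obtain E where E: "E \<in> F" "D \<subseteq> E"
        using cover[OF fin subset_refl _ D(2)] D(1) unfolding union by blast
      then have "C = E" using incomparable[OF C, of E] D(3) by simp
      then show ?thesis using E D(3) by simp
    qed
    moreover have "C \<subseteq> S" using C unfolding union[symmetric] by (rule Union_upper)
    ultimately show "C \<in> irreducible_components S"
      unfolding irreducible_components_def using C closed irr by simp
  qed
qed

section \<open>Polynomial curves and their limits\<close>

lemma range_poly_const [simp, intro]: "(\<lambda>_. a) \<in> range (poly :: complex poly \<Rightarrow> _)"
  by (rule range_eqI[of _ _ "[:a:]"]) auto

lemma range_poly_ident [simp, intro]: "(\<lambda>t. t) \<in> range (poly :: complex poly \<Rightarrow> _)"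
  by (rule range_eqI[of _ _ "[:0,1:]"]) auto

lemma range_poly_add [intro]:
  "p \<in> range poly \<Longrightarrow> q \<in> range poly \<Longrightarrow> (\<lambda>t. p t + q t) \<in> range (poly :: complex poly \<Rightarrow> _)"
  by (auto simp: poly_add[symmetric] simp del: poly_add)

lemma range_poly_mult [intro]:
  "p \<in> range poly \<Longrightarrow> q \<in> range poly \<Longrightarrow> (\<lambda>t. p t * q t) \<in> range (poly :: complex poly \<Rightarrow> _)"
  by (auto simp: poly_mult[symmetric] simp del: poly_mult)

lemma range_poly_uminus [intro]:
  "p \<in> range poly \<Longrightarrow> (\<lambda>t. - p t) \<in> range (poly :: complex poly \<Rightarrow> _)"
  by (auto simp: poly_minus[symmetric] simp del: poly_minus)

lemma range_poly_diff [intro]: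
  "p \<in> range poly \<Longrightarrow> q \<in> range poly \<Longrightarrow> (\<lambda>t. p t - q t) \<in> range (poly :: complex poly \<Rightarrow> _)"
  by (auto simp: poly_diff[symmetric] simp del: poly_diff)

lemma range_poly_power [intro]:
  "p \<in> range poly \<Longrightarrow> (\<lambda>t. p t ^ n) \<in> range (poly :: complex poly \<Rightarrow> _)"
  by (auto simp: poly_power[symmetric] simp del: poly_power)

lemma poly_fun_along_curve:
  assumes "f \<in> poly_fun" "\<And>i. (\<lambda>t. \<gamma> t i) \<in> range poly"
  shows "(\<lambda>t. f (\<gamma> t)) \<in> range (poly :: complex poly \<Rightarrow> _)"
  using assms(1) by induction (auto intro: assms(2))

text \<open>Restricted to the curve, each equation of the closure is a polynomial in
  \<open>t\<close> with infinitely many roots, hence zero.\<close>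

lemma zclosure_limit:
  assumes curve: "\<And>i. (\<lambda>t. \<gamma> t i) \<in> range (poly :: complex poly \<Rightarrow> _)"
    and fin: "finite {t. \<gamma> t \<notin> zclosure U}"
  shows "\<gamma> s \<in> zclosure U"
proof -
  obtain F where F: "F \<subseteq> poly_fun" "zclosure U = {x. \<forall>f\<in>F. f x = 0}"
    using zclosed_zclosure[of U] unfolding zclosed_def by blast
  have "f (\<gamma> s) = 0" if "f \<in> F" for f
  proof -
    have "f \<in> poly_fun" using that F(1) by blast
    from poly_fun_along_curve[where \<gamma> = \<gamma>, OF this curve]
    obtain p where p: "\<And>t. f (\<gamma> t) = poly p t" by (auto simp: fun_eq_iff)
    have "- {t. \<gamma> t \<notin> zclosure U} \<subseteq> {t. poly p t = 0}"
      using that F(2) unfolding p[symmetric] by blast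
    moreover have "infinite (- {t. \<gamma> t \<notin> zclosure U})"
      using fin by (simp add: infinite_UNIV_char_0 Compl_eq_Diff_UNIV)
    ultimately have "p = 0" using poly_roots_finite finite_subset by blast
    then show ?thesis using p by simp
  qed
  then show ?thesis using F(2) by blast
qed

section \<open>Coordinates on the three-dimensional space\<close>

lemma UNIV_3': "(UNIV :: 3 set) = {0, 1, 2}"
  using UNIV_3 by auto

text \<open>Links the library's determinant expansion, indexed by 1, 2, 3, with the indices 0, 1, 2
  used here.\<close>

lemma three_eq_zero: "(3::3) = 0"
  by simp

lemma sum_3': "sum f (UNIV :: 3 set) = f 0 + f 1 + f 2"
  unfolding UNIV_3' by (simp add: add.assoc)

lemma all_3': "(\<forall>i::3. Q i) \<longleftrightarrow> Q 0 \<and> Q 1 \<and> Q 2"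
  using UNIV_3' by (metis UNIV_I empty_iff insert_iff)

lemma vec_eq_3': "(x :: 'a^3) = y \<longleftrightarrow> x$0 = y$0 \<and> x$1 = y$1 \<and> x$2 = y$2"
  by (simp add: vec_eq_iff all_3')

definition vec3 :: "'a \<Rightarrow> 'a \<Rightarrow> 'a \<Rightarrow> 'a^3" where
  "vec3 a b c = (\<chi> i. if i = 0 then a else if i = 1 then b else c)"

lemma vec3_nth [simp]: "vec3 a b c $ 0 = a" "vec3 a b c $ 1 = b" "vec3 a b c $ 2 = c"
  by (simp_all add: vec3_def)

definition det3 :: "complex^3 \<Rightarrow> complex^3 \<Rightarrow> complex^3 \<Rightarrow> complex" where
  "det3 x y z = x$0 * (y$1 * z$2 - y$2 * z$1) - x$1 * (y$0 * z$2 - y$2 * z$0)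
     + x$2 * (y$0 * z$1 - y$1 * z$0)"

lemma det3_cramer: "det3 x y z *s w = det3 w y z *s x + det3 x w z *s y + det3 x y w *s z"
  by (simp add: vec_eq_3' det3_def algebra_simps)

lemma det3_lincomb:
  "det3 (a1 *s x + b1 *s y + c1 *s z) (a2 *s x + b2 *s y + c2 *s z) (a3 *s x + b3 *s y + c3 *s z) =
   (a1 * (b2 * c3 - c2 * b3) - b1 * (a2 * c3 - c2 * a3) + c1 * (a2 * b3 - b2 * a3)) * det3 x y z"
  unfolding det3_def vector_add_component vector_smult_component by (simp add: algebra_simps)

lemma det3_eq_0:
  assumes "det3 x y z \<noteq> 0" "a *s x + b *s y + c *s z = 0"
  shows "a = 0 \<and> b = 0 \<and> c = 0"
proof -
  have "det3 (a *s x + b *s y + c *s z) y z = a * det3 x y z"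
    "det3 x (a *s x + b *s y + c *s z) z = b * det3 x y z"
    "det3 x y (a *s x + b *s y + c *s z) = c * det3 x y z"
    unfolding det3_def vector_add_component vector_smult_component by (simp_all add: algebra_simps)
  moreover have "det3 0 y z = 0" "det3 x 0 z = 0" "det3 x y 0 = 0"
    by (simp_all add: det3_def)
  ultimately show ?thesis using assms by auto
qed

lemma det3_span:
  assumes "det3 x y z \<noteq> 0"
  obtains a b c where "w = a *s x + b *s y + c *s z"
proof
  have "w = (1 / det3 x y z) *s (det3 x y z *s w)"
    using assms by (simp add: vec_eq_3')
  also have "\<dots> = (det3 w y z / det3 x y z) *s x + (det3 x w z / det3 x y z) *s y
      + (det3 x y w / det3 x y z) *s z"
    unfolding det3_cramer[of x y z w] by (simp add: vec_eq_3' algebra_simps)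
  finally show "w = \<dots>" .
qed

text \<open>Testing against the unit vectors gives the 2 by 2 minors of \<open>x\<close> and
  \<open>y\<close>; dividing by a nonzero coordinate of \<open>x\<close> yields the factor.\<close>

lemma det3_zero_imp_dependent:
  assumes "x \<noteq> 0" "\<And>z. det3 x y z = 0"
  shows "\<exists>a. y = a *s x"
proof -
  have m: "x$0 * y$1 = x$1 * y$0" "x$0 * y$2 = x$2 * y$0" "x$1 * y$2 = x$2 * y$1"
    using assms(2)[of "vec3 0 0 1"] assms(2)[of "vec3 0 1 0"] assms(2)[of "vec3 1 0 0"]
    by (simp_all add: det3_def algebra_simps)
  consider "x$0 \<noteq> 0" | "x$1 \<noteq> 0" | "x$2 \<noteq> 0"
    using assms(1) by (auto simp: vec_eq_3')
  then show ?thesis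
  proof cases
    case 1 with m show ?thesis
      by (intro exI[of _ "y$0 / x$0"]) (simp add: vec_eq_3' field_simps)
  next
    case 2 with m show ?thesis
      by (intro exI[of _ "y$1 / x$1"]) (simp add: vec_eq_3' field_simps)
  next
    case 3 with m show ?thesis
      by (intro exI[of _ "y$2 / x$2"]) (simp add: vec_eq_3' field_simps)
  qed
qed

lemma det3_extend:
  assumes "x \<noteq> 0"
  obtains y z where "det3 x y z \<noteq> 0"
proof -
  have "\<exists>y. \<nexists>a. y = a *s x"
  proof (rule ccontr)
    assume "\<not> ?thesis"
    then obtain a b where "vec3 1 0 0 = a *s x" "vec3 0 1 0 = b *s x" by meson
    then show False by (simp add: vec_eq_3') (metis mult_eq_0_iff zero_neq_one)
  qed
  then show ?thesis using det3_zero_imp_dependent[OF assms] that by blast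
qed

section \<open>Bilinear maps, base change and orbits\<close>

lemma bil_nth: "bil b c x y $ k =
   x$0 * y$0 * c (b,0,0,k) + x$0 * y$1 * c (b,0,1,k) + x$0 * y$2 * c (b,0,2,k)
 + (x$1 * y$0 * c (b,1,0,k) + x$1 * y$1 * c (b,1,1,k) + x$1 * y$2 * c (b,1,2,k))
 + (x$2 * y$0 * c (b,2,0,k) + x$2 * y$1 * c (b,2,1,k) + x$2 * y$2 * c (b,2,2,k))"
  by (simp add: bil_def sum_3')

lemma bil_add_left: "bil b c (x + x') y = bil b c x y + bil b c x' y"
  by (simp add: vec_eq_iff bil_nth algebra_simps)

lemma bil_add_right: "bil b c x (y + y') = bil b c x y + bil b c x y'"
  by (simp add: vec_eq_iff bil_nth algebra_simps)

lemma bil_scale_left: "bil b c (a *s x) y = a *s bil b c x y"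
  by (simp add: vec_eq_iff bil_nth algebra_simps)

lemma bil_scale_right: "bil b c x (a *s y) = a *s bil b c x y"
  by (simp add: vec_eq_iff bil_nth algebra_simps)

lemma bil_minus_left: "bil b c (- x) y = - bil b c x y"
  by (simp add: vec_eq_iff bil_nth algebra_simps)

lemma bil_minus_right: "bil b c x (- y) = - bil b c x y"
  by (simp add: vec_eq_iff bil_nth algebra_simps)

lemma bil_diff_left: "bil b c (x - x') y = bil b c x y - bil b c x' y"
  by (simp add: vec_eq_iff bil_nth algebra_simps)

lemma bil_diff_right: "bil b c x (y - y') = bil b c x y - bil b c x y'"
  by (simp add: vec_eq_iff bil_nth algebra_simps)

lemma bil_zero_left [simp]: "bil b c 0 y = 0"
  by (simp add: vec_eq_iff bil_nth)

lemma bil_zero_right [simp]: "bil b c x 0 = 0"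
  by (simp add: vec_eq_iff bil_nth)

lemmas bil_simps = bil_add_left bil_add_right bil_scale_left bil_scale_right
  bil_minus_left bil_minus_right bil_diff_left bil_diff_right

lemma bil_axis: "bil b c (axis i 1) (axis j 1) $ k = c (b,i,j,k)"
proof -
  have "\<forall>i j. bil b c (axis i 1) (axis j 1) $ k = c (b,i,j,k)"
    by (simp add: all_3' bil_nth axis_def)
  then show ?thesis by blast
qed

lemma bil_eqI:
  assumes "\<And>b x y. bil b c x y = bil b d x y"
  shows "c = d"
proof
  fix s :: "bool \<times> 3 \<times> 3 \<times> 3"
  obtain b i j k where "s = (b,i,j,k)" by (cases s)
  then show "c s = d s" using assms bil_axis by metis
qed

lemma matrix_inv_inverse:
  fixes g :: "'a::semiring_1^'n^'n"
  assumes "invertible g"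
  shows "g ** matrix_inv g = mat 1" "matrix_inv g ** g = mat 1"
  using someI_ex[OF assms[unfolded invertible_def]] unfolding matrix_inv_def by auto

text \<open>Moving \<open>g\<close> to the arguments removes the inverse: orbit membership becomes
  the existence of an isomorphism from \<open>d\<close> to \<open>c\<close>.\<close>

lemma orbit_iff: "c \<in> orbit d \<longleftrightarrow>
   (\<exists>g :: complex^3^3. invertible g \<and> (\<forall>b x y. bil b c (g *v x) (g *v y) = g *v bil b d x y))"
proof
  assume "c \<in> orbit d"
  then obtain g :: "complex^3^3" where g: "invertible g"
    "\<And>b x y. bil b c x y = g *v bil b d (matrix_inv g *v x) (matrix_inv g *v y)"
    unfolding orbit_def by auto
  have "matrix_inv g *v (g *v x) = x" for x
    using g(1) by (simp add: matrix_vector_mul_assoc matrix_inv_inverse)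
  then show "\<exists>g :: complex^3^3. invertible g \<and> (\<forall>b x y. bil b c (g *v x) (g *v y) = g *v bil b d x y)"
    using g by (intro exI[of _ g]) simp
next
  assume "\<exists>g :: complex^3^3. invertible g \<and> (\<forall>b x y. bil b c (g *v x) (g *v y) = g *v bil b d x y)"
  then obtain g :: "complex^3^3" where g: "invertible g"
    "\<And>b x y. bil b c (g *v x) (g *v y) = g *v bil b d x y" by auto
  have inv: "g *v (matrix_inv g *v x) = x" for x
    using g(1) by (simp add: matrix_vector_mul_assoc matrix_inv_inverse)
  have "bil b c x y = g *v bil b d (matrix_inv g *v x) (matrix_inv g *v y)" for b x y
    using g(2)[of b "matrix_inv g *v x" "matrix_inv g *v y"] by (simp add: inv)
  then show "c \<in> orbit d"
    unfolding orbit_def using g(1) by blast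
qed

lemma orbit_trans:
  assumes "c \<in> orbit d" "d \<in> orbit e"
  shows "c \<in> orbit e"
proof -
  obtain g h :: "complex^3^3" where "invertible g" "invertible h"
    "\<And>b x y. bil b c (g *v x) (g *v y) = g *v bil b d x y"
    "\<And>b x y. bil b d (h *v x) (h *v y) = h *v bil b e x y"
    using assms unfolding orbit_iff by blast
  then show ?thesis
    unfolding orbit_iff
    by (intro exI[of _ "g ** h"]) (simp add: invertible_mult flip: matrix_vector_mul_assoc)
qed

lemma orbit_sym: "c \<in> orbit d \<Longrightarrow> d \<in> orbit c"
proof -
  assume "c \<in> orbit d"
  then obtain g :: "complex^3^3" where g: "invertible g"
    "\<And>b x y. bil b c (g *v x) (g *v y) = g *v bil b d x y" unfolding orbit_iff by blast
  have inv: "g *v (matrix_inv g *v x) = x" "matrix_inv g *v (g *v x) = x" for x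
    using g(1) by (simp_all add: matrix_vector_mul_assoc matrix_inv_inverse)
  have "invertible (matrix_inv g)"
    unfolding invertible_def using g(1) matrix_inv_inverse by blast
  moreover have "bil b d (matrix_inv g *v x) (matrix_inv g *v y) = matrix_inv g *v bil b c x y" for b x y
    using g(2)[of b "matrix_inv g *v x" "matrix_inv g *v y"] by (simp add: inv)
  ultimately show ?thesis unfolding orbit_iff by blast
qed

lemma orbit_refl: "c \<in> orbit c"
proof -
  have "invertible (mat 1 :: complex^3^3)" unfolding invertible_def using matrix_mul_lid by blast
  then show ?thesis unfolding orbit_iff by (intro exI[of _ "mat 1"]) simp
qed

text \<open>The isomorphism is the matrix with columns \<open>v 0\<close>, \<open>v 1\<close>,
  \<open>v 2\<close>: it suffices to find a basis in which \<open>c\<close> has the structure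
  constants \<open>d\<close>.\<close>

lemma orbit_tableI:
  assumes det: "det3 (v 0) (v 1) (v 2) \<noteq> 0"
    and table: "\<And>b i j. bil b c (v i) (v j)
      = d (b,i,j,0) *s v 0 + d (b,i,j,1) *s v 1 + d (b,i,j,2) *s v 2"
  shows "c \<in> orbit d"
proof -
  define g :: "complex^3^3" where "g = (\<chi> i j. v j $ i)"
  have g: "g *v x = x$0 *s v 0 + x$1 *s v 1 + x$2 *s v 2" for x
    by (simp add: vec_eq_iff matrix_vector_mult_def g_def sum_3' algebra_simps)
  have "det g = det3 (v 0) (v 1) (v 2)"
    by (simp add: det_3 three_eq_zero g_def det3_def algebra_simps)
  then have "invertible g" using det by (simp add: invertible_det_nz)
  moreover have "bil b c (g *v x) (g *v y) = g *v bil b d x y" for b x y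
    unfolding g bil_simps table
    by (simp add: vec_eq_iff bil_nth algebra_simps)
  ultimately show ?thesis unfolding orbit_iff by blast
qed

lemma symtab_commute: "symtab M j i k = symtab M i j k"
  unfolding symtab_def by (induction M) auto

lemma asymtab_anticommute: "asymtab B j i k = - asymtab B i j k"
  unfolding asymtab_def by (induction B) auto

lemma asymtab_self: "asymtab B i i k = 0"
  unfolding asymtab_def by (induction B) auto

lemma orbit_mkstrI:
  assumes det: "det3 x y z \<noteq> 0"
    and comm: "\<And>u w. mul c u w = mul c w u"
    and alt: "\<And>u. br c u u = 0"
    and mul:
      "mul c x x = symtab M 0 0 0 *s x + symtab M 0 0 1 *s y + symtab M 0 0 2 *s z"
      "mul c x y = symtab M 0 1 0 *s x + symtab M 0 1 1 *s y + symtab M 0 1 2 *s z"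
      "mul c x z = symtab M 0 2 0 *s x + symtab M 0 2 1 *s y + symtab M 0 2 2 *s z"
      "mul c y y = symtab M 1 1 0 *s x + symtab M 1 1 1 *s y + symtab M 1 1 2 *s z"
      "mul c y z = symtab M 1 2 0 *s x + symtab M 1 2 1 *s y + symtab M 1 2 2 *s z"
      "mul c z z = symtab M 2 2 0 *s x + symtab M 2 2 1 *s y + symtab M 2 2 2 *s z"
    and br:
      "br c x y = asymtab B 0 1 0 *s x + asymtab B 0 1 1 *s y + asymtab B 0 1 2 *s z"
      "br c x z = asymtab B 0 2 0 *s x + asymtab B 0 2 1 *s y + asymtab B 0 2 2 *s z"
      "br c y z = asymtab B 1 2 0 *s x + asymtab B 1 2 1 *s y + asymtab B 1 2 2 *s z"
  shows "c \<in> orbit (mkstr M B)"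
proof -
  define v where "v = (\<lambda>i::3. if i = 0 then x else if i = 1 then y else z)"
  have v: "v 0 = x" "v 1 = y" "v 2 = z" by (simp_all add: v_def)
  have anti: "br c u w = - br c w u" for u w
    using alt[of "u + w"] by (simp add: bil_simps alt eq_neg_iff_add_eq_0 add.commute)
  have "\<forall>i j. bil True c (v i) (v j) = mkstr M B (True,i,j,0) *s v 0 + mkstr M B (True,i,j,1) *s v 1
      + mkstr M B (True,i,j,2) *s v 2"
    unfolding all_3' v mkstr_def
    by (simp add: br alt anti[of y x] anti[of z x] anti[of z y] asymtab_self
      asymtab_anticommute[of B 1 0] asymtab_anticommute[of B 2 0] asymtab_anticommute[of B 2 1])
  moreover have "\<forall>i j. bil False c (v i) (v j) = mkstr M B (False,i,j,0) *s v 0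
      + mkstr M B (False,i,j,1) *s v 1 + mkstr M B (False,i,j,2) *s v 2"
    unfolding all_3' v mkstr_def
    by (simp add: mul comm[of y x] comm[of z x] comm[of z y]
      symtab_commute[of M 1 0] symtab_commute[of M 2 0] symtab_commute[of M 2 1])
  ultimately have "\<forall>b i j. bil b c (v i) (v j) = mkstr M B (b,i,j,0) *s v 0
      + mkstr M B (b,i,j,1) *s v 1 + mkstr M B (b,i,j,2) *s v 2"
    unfolding all_bool_eq by (rule conjI)
  moreover have "det3 (v 0) (v 1) (v 2) \<noteq> 0" unfolding v by (rule det)
  ultimately show ?thesis by (intro orbit_tableI[of v]) blast+
qed

section \<open>The base change action as a polynomial map\<close>

lemma poly_fun_bil:
  assumes "\<And>i. (\<lambda>c. X c $ i) \<in> poly_fun" "\<And>i. (\<lambda>c. Y c $ i) \<in> poly_fun"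
  shows "(\<lambda>c. bil b c (X c) (Y c) $ k) \<in> poly_fun"
  unfolding bil_nth by (intro poly_fun.add poly_fun.mult poly_fun.coord assms)

text \<open>With \<open>h\<close> independent of \<open>g\<close> the entries are polynomial in
  \<open>g\<close>, \<open>h\<close> and \<open>c\<close> together; the group action is the case
  \<open>h = matrix_inv g\<close>.\<close>

definition act :: "complex^3^3 \<Rightarrow> complex^3^3 \<Rightarrow> pt \<Rightarrow> pt" where
  "act g h c = (\<lambda>(b,i,j,k). (g *v bil b c (column i h) (column j h)) $ k)"

lemma bil_act: "bil b (act g h c) x y = g *v bil b c (h *v x) (h *v y)"
proof -
  have h: "h *v x = x$0 *s column 0 h + x$1 *s column 1 h + x$2 *s column 2 h" for x
    by (simp add: matrix_mult_sum sum_3')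
  show ?thesis
    unfolding h bil_simps
    by (simp add: vec_eq_iff bil_nth[of b "act g h c"] matrix_vector_right_distrib
      vector_scalar_commute algebra_simps) (simp add: act_def)
qed

lemma act_orbit: "invertible g \<Longrightarrow> act g (matrix_inv g) c \<in> orbit c"
  unfolding orbit_def using bil_act by blast

lemma orbit_act:
  assumes "d \<in> orbit c"
  obtains g where "invertible g" "d = act g (matrix_inv g) c"
proof -
  obtain g :: "complex^3^3" where g: "invertible g"
    "\<And>b x y. bil b d x y = g *v bil b c (matrix_inv g *v x) (matrix_inv g *v y)"
    using assms unfolding orbit_def by auto
  then show ?thesis using that bil_eqI[of d "act g (matrix_inv g) c"] bil_act by metis
qed

lemma poly_fun_act: "(\<lambda>c. act g h c s) \<in> poly_fun"
proof -
  obtain b i j k where "s = (b,i,j,k)" by (cases s)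
  then show ?thesis
    by (simp add: act_def matrix_vector_mult_def)
       (intro poly_fun_sum poly_fun.mult poly_fun.const poly_fun_bil)
qed

text \<open>For fixed \<open>g\<close> the action is polynomial in \<open>c\<close>, so the preimage
  of the closure is closed; it contains \<open>U\<close>, hence the closure.\<close>

lemma zclosure_orbit_stable:
  assumes U: "\<And>c d. c \<in> U \<Longrightarrow> d \<in> orbit c \<Longrightarrow> d \<in> U"
    and "c \<in> zclosure U" "d \<in> orbit c"
  shows "d \<in> zclosure U"
proof -
  obtain g where g: "invertible g" "d = act g (matrix_inv g) c"
    using orbit_act assms(3) by blast
  have "zclosed {c. act g (matrix_inv g) c \<in> zclosure U}"
    by (rule zclosed_vimage[OF zclosed_zclosure poly_fun_act])
  moreover have "U \<subseteq> {c. act g (matrix_inv g) c \<in> zclosure U}"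
    using U act_orbit[OF g(1)] zclosure_subset[of U] by blast
  ultimately show ?thesis using zclosure_minimal[of U] assms(2) g(2) by blast
qed

text \<open>\<open>D\<close> will be the determinant along a line of matrices. Nothing is demanded
  where it vanishes, since \<open>matrix_inv\<close> has no meaningful value there.\<close>

definition rational_curve :: "(complex \<Rightarrow> complex) \<Rightarrow> (complex \<Rightarrow> complex) \<Rightarrow> bool" where
  "rational_curve D f \<longleftrightarrow> (\<exists>p n. \<forall>t. D t \<noteq> 0 \<longrightarrow> f t * D t ^ n = poly p t)"

lemma rational_curve_poly: "f \<in> range poly \<Longrightarrow> rational_curve D f"
  unfolding rational_curve_def by (auto intro!: exI[of _ "0::nat"])

lemma rational_curve_add:
  assumes D: "D \<in> range poly" and "rational_curve D f" "rational_curve D g"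
  shows "rational_curve D (\<lambda>t. f t + g t)"
proof -
  obtain d where d: "D = poly d" using D by auto
  obtain p n q m where pq: "\<And>t. D t \<noteq> 0 \<Longrightarrow> f t * D t ^ n = poly p t" "\<And>t. D t \<noteq> 0 \<Longrightarrow> g t * D t ^ m = poly q t"
    using assms unfolding rational_curve_def by metis
  have "(f t + g t) * D t ^ (n + m) = poly (p * d ^ m + q * d ^ n) t" if "D t \<noteq> 0" for t
    by (simp add: pq[OF that, symmetric] d power_add algebra_simps)
  then show ?thesis unfolding rational_curve_def by blast
qed

lemma rational_curve_mult:
  assumes "rational_curve D f" "rational_curve D g"
  shows "rational_curve D (\<lambda>t. f t * g t)"
proof -
  obtain p n q m where pq: "\<And>t. D t \<noteq> 0 \<Longrightarrow> f t * D t ^ n = poly p t" "\<And>t. D t \<noteq> 0 \<Longrightarrow> g t * D t ^ m = poly q t"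
    using assms unfolding rational_curve_def by metis
  have "(f t * g t) * D t ^ (n + m) = poly (p * q) t" if "D t \<noteq> 0" for t
    by (simp add: pq[OF that, symmetric] power_add algebra_simps)
  then show ?thesis unfolding rational_curve_def by blast
qed

lemma poly_fun_rational_curve:
  assumes "D \<in> range poly" "f \<in> poly_fun" "\<And>i. rational_curve D (\<lambda>t. \<gamma> t i)"
  shows "rational_curve D (\<lambda>t. f (\<gamma> t))"
  using assms(2)
  by induction (auto intro: assms rational_curve_poly rational_curve_add rational_curve_mult)

text \<open>Cramer's rule for the equation that column \<open>j\<close> of the inverse is mapped by
  \<open>g\<close> to the unit vector \<open>j\<close>.\<close>

lemma matrix_inv_adjugate:
  fixes g :: "complex^3^3"
  assumes "det g \<noteq> 0"
  shows "matrix_inv g $ k $ j * det g = det (\<chi> i l. if l = k then axis j 1 $ i else g $ i $ l)"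
proof -
  have "g *v column j (matrix_inv g) = column j (g ** matrix_inv g)"
    by (simp add: vec_eq_iff column_def matrix_vector_mult_def matrix_matrix_mult_def)
  then have "g *v column j (matrix_inv g) = axis j 1"
    using assms by (simp add: matrix_inv_inverse invertible_det_nz column_def mat_def axis_def vec_eq_iff)
  then have "column j (matrix_inv g) = (\<chi> k. det (\<chi> i l. if l = k then axis j 1 $ i else g $ i $ l) / det g)"
    using cramer[OF assms] by blast
  then show ?thesis using assms by (simp add: column_def vec_eq_iff)
qed

text \<open>Two points of the family are joined by the image of a line in the space of pairs
  (group element, parameter), on which polynomial functions restrict to rational functions of one
  variable; hence the product of two functions that do not vanish identically does not either.\<close>

lemma zirreducible_orbit_family:
  assumes P: "\<And>s. (\<lambda>\<alpha>. P \<alpha> s) \<in> range (poly :: complex poly \<Rightarrow> _)"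
  shows "zirreducible (zclosure (\<Union>\<alpha>. orbit (P \<alpha>)))"
proof -
  let ?U = "\<Union>\<alpha>. orbit (P \<alpha>)"
  have "zclosure ?U \<noteq> {}" using zclosure_subset[of ?U] orbit_refl by blast
  moreover have "zclosure ?U \<subseteq> A \<or> zclosure ?U \<subseteq> B"
    if AB: "zclosed A" "zclosed B" "zclosure ?U \<subseteq> A \<union> B" for A B
  proof (rule ccontr)
    assume "\<not> ?thesis"
    then have "\<not> ?U \<subseteq> A" "\<not> ?U \<subseteq> B" using zclosure_minimal AB by blast+
    then obtain c1 c2 where c: "c1 \<in> ?U" "c1 \<notin> A" "c2 \<in> ?U" "c2 \<notin> B" by blast
    obtain f1 where f1: "f1 \<in> poly_fun" "f1 c1 \<noteq> 0" "\<And>x. x \<in> A \<Longrightarrow> f1 x = 0"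
      using AB(1) c(2) unfolding zclosed_def by blast
    obtain f2 where f2: "f2 \<in> poly_fun" "f2 c2 \<noteq> 0" "\<And>x. x \<in> B \<Longrightarrow> f2 x = 0"
      using AB(2) c(4) unfolding zclosed_def by blast
    obtain a1 a2 where "c1 \<in> orbit (P a1)" "c2 \<in> orbit (P a2)" using c by blast
    then obtain g1 g2 where g: "invertible g1" "c1 = act g1 (matrix_inv g1) (P a1)"
      "invertible g2" "c2 = act g2 (matrix_inv g2) (P a2)"
      using orbit_act by metis
    \<comment> \<open>Only the endpoints of this segment are known to be invertible; that already
      makes \<open>D\<close> a nonzero polynomial.\<close>
    define G where "G = (\<lambda>t::complex. (\<chi> i j. g1 $ i $ j + t * (g2 $ i $ j - g1 $ i $ j)) :: complex^3^3)"
    define D where "D = (\<lambda>t. det (G t))"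
    define \<gamma> where "\<gamma> = (\<lambda>t. act (G t) (matrix_inv (G t)) (P (a1 + t * (a2 - a1))))"
    have G01: "G 0 = g1" "G 1 = g2" by (simp_all add: G_def vec_eq_iff)
    then have \<gamma>01: "\<gamma> 0 = c1" "\<gamma> 1 = c2" by (simp_all add: \<gamma>_def g)
    have G: "(\<lambda>t. G t $ i $ j) \<in> range poly" for i j
      unfolding G_def unfolding vec_lambda_beta
      by (intro range_poly_add range_poly_mult range_poly_const range_poly_ident)
    have D: "D \<in> range poly"
      unfolding D_def det_3 by (intro range_poly_add range_poly_diff range_poly_mult G)
    have H: "rational_curve D (\<lambda>t. matrix_inv (G t) $ k $ j)" for k j
    proof -
      have "(\<lambda>t. det ((\<chi> i l. if l = k then axis j 1 $ i else G t $ i $ l) :: complex^3^3)) \<in> range poly"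
        unfolding det_3 by (intro range_poly_add range_poly_diff range_poly_mult)
          (cases "k = 1"; cases "k = 2"; cases "k = 3"; simp add: G)+
      then obtain p where p: "\<And>t. det ((\<chi> i l. if l = k then axis j 1 $ i else G t $ i $ l) :: complex^3^3) = poly p t"
        by (auto simp: fun_eq_iff)
      show ?thesis unfolding rational_curve_def
        by (rule exI[of _ p], rule exI[of _ 1]) (use p matrix_inv_adjugate in \<open>auto simp: D_def\<close>)
    qed
    have Pt: "(\<lambda>t. P (a1 + t * (a2 - a1)) s) \<in> range poly" for s
    proof -
      obtain p where "\<And>\<alpha>. P \<alpha> s = poly p \<alpha>" using P[of s] by (auto simp: fun_eq_iff)
      then have "(\<lambda>t. P (a1 + t * (a2 - a1)) s) = poly (pcompose p [:a1, a2 - a1:])"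
        by (simp add: fun_eq_iff poly_pcompose)
      then show ?thesis by blast
    qed
    have \<gamma>: "rational_curve D (\<lambda>t. \<gamma> t s)" for s
    proof -
      obtain b i j k where s: "s = (b,i,j,k)" by (cases s)
      show ?thesis
        unfolding s \<gamma>_def act_def
        by (simp add: matrix_vector_mult_def sum_3' bil_nth column_def)
          (intro rational_curve_add rational_curve_mult D H rational_curve_poly[OF G] rational_curve_poly[OF Pt])
    qed
    obtain p1 n1 p2 n2 where p: "\<And>t. D t \<noteq> 0 \<Longrightarrow> f1 (\<gamma> t) * D t ^ n1 = poly p1 t"
      "\<And>t. D t \<noteq> 0 \<Longrightarrow> f2 (\<gamma> t) * D t ^ n2 = poly p2 t"
      using poly_fun_rational_curve[OF D f1(1), of \<gamma>] poly_fun_rational_curve[OF D f2(1), of \<gamma>] \<gamma>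
      unfolding rational_curve_def by metis
    obtain d where d: "\<And>t. D t = poly d t" using D by (auto simp: fun_eq_iff)
    have D01: "D 0 \<noteq> 0" "D 1 \<noteq> 0" using g by (simp_all add: D_def G01 invertible_det_nz)
    have "p1 \<noteq> 0" using p(1)[OF D01(1)] D01(1) f1(2) by (auto simp: \<gamma>01)
    moreover have "p2 \<noteq> 0" using p(2)[OF D01(2)] D01(2) f2(2) by (auto simp: \<gamma>01)
    moreover have "d \<noteq> 0" using d D01 by force
    ultimately have "p1 * p2 * d \<noteq> 0" by simp
    \<comment> \<open>At this \<open>t\<close> the matrix \<open>G t\<close> is invertible and
      neither function vanishes at \<open>\<gamma> t\<close>, although this point lies in
      \<open>A \<union> B\<close>.\<close>
    then obtain t where t: "poly (p1 * p2 * d) t \<noteq> 0" by (metis poly_all_0_iff_0)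
    then have Dt: "D t \<noteq> 0" by (simp add: d)
    then have "\<gamma> t \<in> ?U" unfolding \<gamma>_def using act_orbit by (auto simp: D_def invertible_det_nz)
    then have "\<gamma> t \<in> A \<union> B" using AB(3) zclosure_subset[of ?U] by blast
    then show False using f1(3)[of "\<gamma> t"] f2(3)[of "\<gamma> t"] p[OF Dt] t Dt by auto
  qed
  ultimately show ?thesis unfolding zirreducible_def by blast
qed

section \<open>The six families and their separation\<close>

lemma mul_P3_4: "mul (P3_4 \<alpha>) x y = 0"
  by (simp add: vec_eq_3' bil_nth P3_4_def mkstr_def symtab_def)

lemma br_P3_4: "br (P3_4 \<alpha>) x y = vec3 0 (x$0 * y$1 - x$1 * y$0) (\<alpha> * (x$0 * y$2 - x$2 * y$0))"
  by (simp add: vec_eq_3' bil_nth P3_4_def mkstr_def asymtab_def algebra_simps)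

lemma mul_P3_5: "mul P3_5 x y = 0"
  by (simp add: vec_eq_3' bil_nth P3_5_def mkstr_def symtab_def)

lemma br_P3_5: "br P3_5 x y = vec3 (- 2 * (x$0 * y$2 - x$2 * y$0)) (2 * (x$1 * y$2 - x$2 * y$1))
    (x$0 * y$1 - x$1 * y$0)"
  by (simp add: vec_eq_3' bil_nth P3_5_def mkstr_def asymtab_def algebra_simps)

lemma mul_P3_7: "mul P3_7 x y = vec3 (x$0 * y$0) (x$1 * y$1) (x$2 * y$2)"
  by (simp add: vec_eq_3' bil_nth P3_7_def mkstr_def symtab_def)

lemma br_P3_7: "br P3_7 x y = 0"
  by (simp add: vec_eq_3' bil_nth P3_7_def mkstr_def asymtab_def)

lemma mul_P3_16: "mul (P3_16 \<alpha>) x y = vec3 0 0 (x$0 * y$1 + x$1 * y$0)"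
  by (simp add: vec_eq_3' bil_nth P3_16_def mkstr_def symtab_def)

lemma br_P3_16: "br (P3_16 \<alpha>) x y = vec3 0 0 (\<alpha> * (x$0 * y$1 - x$1 * y$0))"
  by (simp add: vec_eq_3' bil_nth P3_16_def mkstr_def asymtab_def algebra_simps)

lemma mul_P3_18: "mul P3_18 x y = vec3 (x$0 * y$0) (x$0 * y$1 + x$1 * y$0) (x$0 * y$2 + x$2 * y$0)"
  by (simp add: vec_eq_3' bil_nth P3_18_def mkstr_def symtab_def)

lemma br_P3_18: "br P3_18 x y = vec3 0 (x$1 * y$2 - x$2 * y$1) 0"
  by (simp add: vec_eq_3' bil_nth P3_18_def mkstr_def asymtab_def algebra_simps)

lemma mul_P3_20: "mul P3_20 x y = vec3 (x$0 * y$0) 0 0"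
  by (simp add: vec_eq_3' bil_nth P3_20_def mkstr_def symtab_def)

lemma br_P3_20: "br P3_20 x y = vec3 0 (x$1 * y$2 - x$2 * y$1) 0"
  by (simp add: vec_eq_3' bil_nth P3_20_def mkstr_def asymtab_def algebra_simps)

lemmas structure_simps = mul_P3_4 br_P3_4 mul_P3_5 br_P3_5 mul_P3_7 br_P3_7 mul_P3_16 br_P3_16
  mul_P3_18 br_P3_18 mul_P3_20 br_P3_20

lemma structures_poisson:
  "P3_4 \<alpha> \<in> P3" "P3_5 \<in> P3" "P3_7 \<in> P3" "P3_16 \<alpha> \<in> P3" "P3_18 \<in> P3" "P3_20 \<in> P3"
  by (simp_all add: P3_def is_poisson_def structure_simps vec_eq_3' algebra_simps)

lemma orbit_mutually_inverse:
  assumes "c \<in> orbit d"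
  shows "\<exists>(g :: complex^3^3) h. g ** h = mat 1 \<and> h ** g = mat 1 \<and>
    (\<forall>b x y. bil b c x y = g *v bil b d (h *v x) (h *v y))"
proof -
  obtain g :: "complex^3^3" where "invertible g"
    "\<And>b x y. bil b c x y = g *v bil b d (matrix_inv g *v x) (matrix_inv g *v y)"
    using assms unfolding orbit_def by auto
  then show ?thesis using matrix_inv_inverse[of g] by blast
qed

lemma P3_orbit:
  assumes "c \<in> orbit d" "d \<in> P3"
  shows "c \<in> P3"
proof -
  obtain g h :: "complex^3^3" where "g ** h = mat 1" and gh: "h ** g = mat 1"
    "\<And>b x y. bil b c x y = g *v bil b d (h *v x) (h *v y)"
    using orbit_mutually_inverse[OF assms(1)] by blast
  have hg: "h *v (g *v x) = x" for x by (simp add: matrix_vector_mul_assoc gh(1))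
  have d: "mul d x y = mul d y x" "mul d (mul d x y) z = mul d x (mul d y z)" "br d x x = 0"
    "br d x (br d y z) + br d y (br d z x) + br d z (br d x y) = 0"
    "br d (mul d x y) z = mul d (br d x z) y + mul d x (br d y z)" for x y z
    using assms(2) unfolding P3_def is_poisson_def by auto
  have "is_poisson c"
    unfolding is_poisson_def gh(2) hg matrix_vector_right_distrib[symmetric]
  proof (intro conjI allI)
    fix x y z
    show "g *v mul d (h *v x) (h *v y) = g *v mul d (h *v y) (h *v x)"
      by (rule arg_cong[OF d(1)])
    show "g *v mul d (mul d (h *v x) (h *v y)) (h *v z)
        = g *v mul d (h *v x) (mul d (h *v y) (h *v z))"
      by (rule arg_cong[OF d(2)])
    show "g *v br d (h *v x) (h *v x) = 0" by (simp add: d(3))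
    show "g *v (br d (h *v x) (br d (h *v y) (h *v z)) + br d (h *v y) (br d (h *v z) (h *v x))
        + br d (h *v z) (br d (h *v x) (h *v y))) = 0" by (simp add: d(4))
    show "g *v br d (mul d (h *v x) (h *v y)) (h *v z)
        = g *v (mul d (br d (h *v x) (h *v z)) (h *v y) + mul d (h *v x) (br d (h *v y) (h *v z)))"
      by (rule arg_cong[OF d(5)])
  qed
  then show ?thesis by (simp add: P3_def)
qed

lemma zclosed_P3: "zclosed P3"
  unfolding P3_def is_poisson_def vec_eq_iff vector_add_component zero_index
  by (intro zclosed_Collect_conj zclosed_Collect_all zclosed_Collect_eq poly_fun.add poly_fun_bil
      poly_fun.const)

section \<open>Closed conditions invariant under base change\<close>

definition tr :: "bool \<Rightarrow> pt \<Rightarrow> complex^3 \<Rightarrow> complex" where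
  "tr b c x = bil b c x (axis 0 1) $ 0 + bil b c x (axis 1 1) $ 1 + bil b c x (axis 2 1) $ 2"

text \<open>The operator of \<open>c\<close> at \<open>x\<close> is the conjugate by
  \<open>g\<close> of the operator of \<open>d\<close> at \<open>h *v x\<close>, and the trace is
  cyclic.\<close>

lemma tr_orbit:
  assumes "h ** g = mat 1" "\<And>b x y. bil b c x y = g *v bil b d (h *v x) (h *v y)"
  shows "tr b c x = tr b d (h *v x)"
proof -
  define A :: "complex^3^3" where "A = (\<chi> i j. bil b d (h *v x) (axis j 1) $ i)"
  have A: "bil b d (h *v x) y = A *v y" for y
    by (simp add: A_def vec_eq_iff matrix_vector_mult_def sum_3' bil_nth axis_def algebra_simps)
  have diag: "(M *v axis k 1) $ k = M $ k $ k" for M :: "complex^3^3" and k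
    by (simp add: matrix_vector_mult_def axis_def if_distrib cong: if_cong)
  have "tr b c x = trace (g ** (A ** h))"
    by (simp add: tr_def assms(2) A matrix_vector_mul_assoc diag trace_def sum_3')
  also have "\<dots> = trace ((A ** h) ** g)" by (rule trace_mul_sym)
  also have "\<dots> = trace A" by (simp add: assms(1) flip: matrix_mul_assoc)
  also have "\<dots> = tr b d (h *v x)" by (simp add: tr_def A diag trace_def sum_3')
  finally show ?thesis .
qed

text \<open>Equality of the tensors \<open>u\<close> by \<open>u'\<close> and \<open>w\<close> by
  \<open>w'\<close>. It is polynomial and survives every linear map; with the right pair being the
  left one swapped, it says that \<open>u\<close> and \<open>u'\<close> are parallel.\<close>

definition tensor_eq :: "complex^3 \<Rightarrow> complex^3 \<Rightarrow> complex^3 \<Rightarrow> complex^3 \<Rightarrow> bool" where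
  "tensor_eq u u' w w' \<longleftrightarrow> (\<forall>i j. u$i * u'$j = w$i * w'$j)"

lemma tensor_eq_image:
  assumes "tensor_eq u u' w w'"
  shows "tensor_eq (g *v u) (g *v u') (g *v w) (g *v w')"
proof -
  have "(g *v u) $ i * (g *v u') $ j = (\<Sum>k\<in>UNIV. \<Sum>l\<in>UNIV. g$i$k * g$j$l * (u$k * u'$l))" for i j u u'
    by (simp add: matrix_vector_mult_def sum_3' algebra_simps)
  then show ?thesis using assms unfolding tensor_eq_def by simp
qed

text \<open>Three times the traceless part of multiplication by \<open>v\<close>, which avoids a
  division.\<close>

definition mul_traceless :: "pt \<Rightarrow> complex^3 \<Rightarrow> complex^3 \<Rightarrow> complex^3" where
  "mul_traceless c v x = 3 *s mul c v x - tr False c v *s x"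

lemma poly_fun_tr: "(\<lambda>c. tr b c x) \<in> poly_fun"
  unfolding tr_def by (intro poly_fun.add poly_fun_bil poly_fun.const)

text \<open>Metabelian Lie algebras, which excludes \<open>P3_5\<close> because it equals its
  derived algebra.\<close>

definition sep4 :: "pt \<Rightarrow> bool" where
  "sep4 c \<longleftrightarrow> (\<forall>x y. mul c x y = 0) \<and> (\<forall>x y z w. br c (br c x y) (br c z w) = 0)"

definition sep5 :: "pt \<Rightarrow> bool" where
  "sep5 c \<longleftrightarrow> (\<forall>x y. mul c x y = 0) \<and> (\<forall>x. tr True c x = 0)"

definition sep7 :: "pt \<Rightarrow> bool" where
  "sep7 c \<longleftrightarrow> (\<forall>x y. br c x y = 0)"

definition sep16 :: "pt \<Rightarrow> bool" where
  "sep16 c \<longleftrightarrow> (\<forall>x y z. mul c (mul c x y) z = 0) \<and> (\<forall>x y z. br c (br c x y) z = 0)"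

text \<open>The brackets lie on a line. In \<open>P3_18\<close> the traceless operator sends
  \<open>x\<close> to \<open>3 x_0 (0, v_1, v_2)\<close>, a covector in \<open>x\<close> times a
  vector in \<open>v\<close>; such a product allows \<open>x\<close> and \<open>y\<close> to be
  exchanged.\<close>

definition sep18 :: "pt \<Rightarrow> bool" where
  "sep18 c \<longleftrightarrow> (\<forall>x y z w. tensor_eq (br c x y) (br c z w) (br c z w) (br c x y)) \<and>
    (\<forall>v w x y. tensor_eq (mul_traceless c v x) (mul_traceless c w y)
      (mul_traceless c v y) (mul_traceless c w x))"

text \<open>In \<open>P3_20\<close> the product is \<open>x_0 y_0\<close> times a fixed vector, so
  four arguments may be regrouped freely.\<close>

definition sep20 :: "pt \<Rightarrow> bool" where
  "sep20 c \<longleftrightarrow> (\<forall>x y z w. tensor_eq (br c x y) (br c z w) (br c z w) (br c x y)) \<and>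
    (\<forall>x y z w. tensor_eq (mul c x y) (mul c z w) (mul c x z) (mul c y w))"

lemmas sep_defs = sep4_def sep5_def sep7_def sep16_def sep18_def sep20_def

lemma zclosed_sep:
  "zclosed {c. sep4 c}" "zclosed {c. sep5 c}" "zclosed {c. sep7 c}" "zclosed {c. sep16 c}"
  "zclosed {c. sep18 c}" "zclosed {c. sep20 c}"
  unfolding sep_defs tensor_eq_def mul_traceless_def vec_eq_iff zero_index vector_minus_component
    vector_smult_component
  by (intro zclosed_Collect_conj zclosed_Collect_all zclosed_Collect_eq poly_fun_diff poly_fun.mult
      poly_fun_bil poly_fun_tr poly_fun.const)+

lemma sep_orbit:
  assumes "c \<in> orbit d"
  shows "sep4 d \<Longrightarrow> sep4 c" "sep5 d \<Longrightarrow> sep5 c" "sep7 d \<Longrightarrow> sep7 c" "sep16 d \<Longrightarrow> sep16 c"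
    "sep18 d \<Longrightarrow> sep18 c" "sep20 d \<Longrightarrow> sep20 c"
proof -
  obtain g h :: "complex^3^3" where gh: "g ** h = mat 1" "h ** g = mat 1"
    "\<And>b x y. bil b c x y = g *v bil b d (h *v x) (h *v y)"
    using orbit_mutually_inverse[OF assms] by blast
  have hg: "h *v (g *v x) = x" "g *v (h *v x) = x" for x
    by (simp_all add: matrix_vector_mul_assoc gh(1,2))
  have N: "mul_traceless c v x = g *v mul_traceless d (h *v v) (h *v x)" for v x
    unfolding mul_traceless_def tr_orbit[OF gh(2,3)] gh(3)
    by (simp add: matrix_vector_mult_diff_distrib vector_scalar_commute hg)
  show "sep4 d \<Longrightarrow> sep4 c" "sep5 d \<Longrightarrow> sep5 c" "sep7 d \<Longrightarrow> sep7 c" "sep16 d \<Longrightarrow> sep16 c"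
    by (simp_all add: sep_defs gh(3) hg tr_orbit[OF gh(2,3)])
  show "sep18 d \<Longrightarrow> sep18 c"
    unfolding sep18_def N gh(3) by (blast intro: tensor_eq_image)
  show "sep20 d \<Longrightarrow> sep20 c"
    unfolding sep20_def gh(3) by (blast intro: tensor_eq_image)
qed

lemma sep_structures:
  "sep4 (P3_4 \<alpha>)" "sep5 P3_5" "sep7 P3_7" "sep16 (P3_16 \<alpha>)" "sep18 P3_18" "sep20 P3_20"
  by (simp_all add: sep_defs structure_simps tr_def mul_traceless_def axis_def tensor_eq_def all_3'
      vec_eq_3' algebra_simps)

section \<open>The six orbit families and their pairwise non-inclusion\<close>

definition U4 :: "pt set" where "U4 = (\<Union>\<alpha>. orbit (P3_4 \<alpha>))"
definition U5 :: "pt set" where "U5 = orbit P3_5"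
definition U7 :: "pt set" where "U7 = orbit P3_7"
definition U16 :: "pt set" where "U16 = (\<Union>\<alpha>. orbit (P3_16 \<alpha>))"
definition U18 :: "pt set" where "U18 = orbit P3_18"
definition U20 :: "pt set" where "U20 = orbit P3_20"

lemmas U_defs = U4_def U5_def U7_def U16_def U18_def U20_def

lemma U_orbit:
  assumes "d \<in> orbit c"
  shows "c \<in> U4 \<Longrightarrow> d \<in> U4" "c \<in> U5 \<Longrightarrow> d \<in> U5" "c \<in> U7 \<Longrightarrow> d \<in> U7"
    "c \<in> U16 \<Longrightarrow> d \<in> U16" "c \<in> U18 \<Longrightarrow> d \<in> U18" "c \<in> U20 \<Longrightarrow> d \<in> U20"
  unfolding U_defs using orbit_trans[OF assms] by blast+

lemma zclosure_U_sep:
  "c \<in> zclosure U4 \<Longrightarrow> sep4 c" "c \<in> zclosure U5 \<Longrightarrow> sep5 c" "c \<in> zclosure U7 \<Longrightarrow> sep7 c"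
  "c \<in> zclosure U16 \<Longrightarrow> sep16 c" "c \<in> zclosure U18 \<Longrightarrow> sep18 c" "c \<in> zclosure U20 \<Longrightarrow> sep20 c"
proof -
  have "U4 \<subseteq> {c. sep4 c}" "U5 \<subseteq> {c. sep5 c}" "U7 \<subseteq> {c. sep7 c}" "U16 \<subseteq> {c. sep16 c}"
    "U18 \<subseteq> {c. sep18 c}" "U20 \<subseteq> {c. sep20 c}"
    unfolding U_defs using sep_orbit sep_structures by blast+
  then show "c \<in> zclosure U4 \<Longrightarrow> sep4 c" "c \<in> zclosure U5 \<Longrightarrow> sep5 c" "c \<in> zclosure U7 \<Longrightarrow> sep7 c"
    "c \<in> zclosure U16 \<Longrightarrow> sep16 c" "c \<in> zclosure U18 \<Longrightarrow> sep18 c" "c \<in> zclosure U20 \<Longrightarrow> sep20 c"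
    using zclosure_minimal zclosed_sep by blast+
qed

lemma structures_in_zclosure:
  "P3_4 \<alpha> \<in> zclosure U4" "P3_5 \<in> zclosure U5" "P3_7 \<in> zclosure U7" "P3_16 \<alpha> \<in> zclosure U16"
  "P3_18 \<in> zclosure U18" "P3_20 \<in> zclosure U20"
  unfolding U_defs by (rule subsetD[OF zclosure_subset], use orbit_refl in blast)+

text \<open>To be read backwards: each structure listed, put for \<open>c\<close>, violates the
  hypothesis.\<close>

lemma mul_separates:
  assumes "\<forall>x y. mul c x y = 0"
  shows "c \<noteq> P3_7" "c \<noteq> P3_16 1" "c \<noteq> P3_18" "c \<noteq> P3_20"
proof -
  have "mul P3_7 (vec3 1 1 1) (vec3 1 1 1) \<noteq> 0" "mul (P3_16 1) (vec3 1 1 1) (vec3 1 1 1) \<noteq> 0"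
    "mul P3_18 (vec3 1 1 1) (vec3 1 1 1) \<noteq> 0" "mul P3_20 (vec3 1 1 1) (vec3 1 1 1) \<noteq> 0"
    by (simp_all add: structure_simps vec_eq_3')
  then show "c \<noteq> P3_7" "c \<noteq> P3_16 1" "c \<noteq> P3_18" "c \<noteq> P3_20" using assms by metis+
qed

lemma br_parallel_separates:
  assumes "\<forall>x y z w. tensor_eq (br c x y) (br c z w) (br c z w) (br c x y)"
  shows "c \<noteq> P3_4 2" "c \<noteq> P3_5"
proof -
  have "\<not> tensor_eq (br (P3_4 2) (vec3 1 0 0) (vec3 0 1 0)) (br (P3_4 2) (vec3 1 0 0) (vec3 0 0 1))
      (br (P3_4 2) (vec3 1 0 0) (vec3 0 0 1)) (br (P3_4 2) (vec3 1 0 0) (vec3 0 1 0))"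
    "\<not> tensor_eq (br P3_5 (vec3 1 0 0) (vec3 0 1 0)) (br P3_5 (vec3 1 0 0) (vec3 0 0 1))
      (br P3_5 (vec3 1 0 0) (vec3 0 0 1)) (br P3_5 (vec3 1 0 0) (vec3 0 1 0))"
    by (simp_all add: structure_simps tensor_eq_def all_3')
  then show "c \<noteq> P3_4 2" "c \<noteq> P3_5" using assms by metis+
qed

lemma not_sep4: "\<not> sep4 P3_5" "\<not> sep4 P3_7" "\<not> sep4 (P3_16 1)" "\<not> sep4 P3_18" "\<not> sep4 P3_20"
proof -
  have "br P3_5 (br P3_5 (vec3 1 0 0) (vec3 0 1 0)) (br P3_5 (vec3 1 0 0) (vec3 0 0 1)) \<noteq> 0"
    by (simp add: structure_simps vec_eq_3')
  then show "\<not> sep4 P3_5" unfolding sep4_def by blast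
qed (use mul_separates sep4_def in blast)+

text \<open>The trace of \<open>ad e_1\<close> in \<open>P3_4 \<alpha>\<close> is
  \<open>1 + \<alpha>\<close>. The value 2 used for separation avoids -1, and also 0, where all
  brackets would lie on one line.\<close>

lemma not_sep5: "\<not> sep5 (P3_4 2)" "\<not> sep5 P3_7" "\<not> sep5 (P3_16 1)" "\<not> sep5 P3_18" "\<not> sep5 P3_20"
proof -
  have "tr True (P3_4 2) (vec3 1 0 0) \<noteq> 0"
    by (simp add: structure_simps tr_def axis_def)
  then show "\<not> sep5 (P3_4 2)" unfolding sep5_def by blast
qed (use mul_separates sep5_def in blast)+

lemma not_sep7: "\<not> sep7 (P3_4 2)" "\<not> sep7 P3_5" "\<not> sep7 (P3_16 1)" "\<not> sep7 P3_18" "\<not> sep7 P3_20"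
proof -
  have "br (P3_4 2) (vec3 1 0 0) (vec3 0 1 0) \<noteq> 0" "br P3_5 (vec3 1 0 0) (vec3 0 1 0) \<noteq> 0"
    "br (P3_16 1) (vec3 1 0 0) (vec3 0 1 0) \<noteq> 0" "br P3_18 (vec3 0 1 0) (vec3 0 0 1) \<noteq> 0"
    "br P3_20 (vec3 0 1 0) (vec3 0 0 1) \<noteq> 0"
    by (simp_all add: structure_simps vec_eq_3')
  then show "\<not> sep7 (P3_4 2)" "\<not> sep7 P3_5" "\<not> sep7 (P3_16 1)" "\<not> sep7 P3_18" "\<not> sep7 P3_20"
    unfolding sep7_def by blast+
qed

lemma not_sep16: "\<not> sep16 (P3_4 2)" "\<not> sep16 P3_5" "\<not> sep16 P3_7" "\<not> sep16 P3_18" "\<not> sep16 P3_20"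
proof -
  have "br (P3_4 2) (br (P3_4 2) (vec3 1 0 0) (vec3 0 1 0)) (vec3 1 0 0) \<noteq> 0"
    "br P3_5 (br P3_5 (vec3 1 0 0) (vec3 0 1 0)) (vec3 1 0 0) \<noteq> 0"
    "mul P3_7 (mul P3_7 (vec3 1 0 0) (vec3 1 0 0)) (vec3 1 0 0) \<noteq> 0"
    "mul P3_18 (mul P3_18 (vec3 1 0 0) (vec3 1 0 0)) (vec3 1 0 0) \<noteq> 0"
    "mul P3_20 (mul P3_20 (vec3 1 0 0) (vec3 1 0 0)) (vec3 1 0 0) \<noteq> 0"
    by (simp_all add: structure_simps vec_eq_3')
  then show "\<not> sep16 (P3_4 2)" "\<not> sep16 P3_5" "\<not> sep16 P3_7" "\<not> sep16 P3_18" "\<not> sep16 P3_20"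
    unfolding sep16_def by blast+
qed

lemma not_sep18: "\<not> sep18 (P3_4 2)" "\<not> sep18 P3_5" "\<not> sep18 P3_7" "\<not> sep18 (P3_16 1)" "\<not> sep18 P3_20"
proof -
  have "\<not> tensor_eq (mul_traceless P3_7 (vec3 1 0 0) (vec3 1 0 0)) (mul_traceless P3_7 (vec3 1 0 0) (vec3 0 1 0))
      (mul_traceless P3_7 (vec3 1 0 0) (vec3 0 1 0)) (mul_traceless P3_7 (vec3 1 0 0) (vec3 1 0 0))"
    "\<not> tensor_eq (mul_traceless P3_20 (vec3 1 0 0) (vec3 1 0 0)) (mul_traceless P3_20 (vec3 1 0 0) (vec3 0 1 0))
      (mul_traceless P3_20 (vec3 1 0 0) (vec3 0 1 0)) (mul_traceless P3_20 (vec3 1 0 0) (vec3 1 0 0))"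
    "\<not> tensor_eq (mul_traceless (P3_16 1) (vec3 1 0 0) (vec3 0 1 0)) (mul_traceless (P3_16 1) (vec3 0 1 0) (vec3 1 0 0))
      (mul_traceless (P3_16 1) (vec3 1 0 0) (vec3 1 0 0)) (mul_traceless (P3_16 1) (vec3 0 1 0) (vec3 0 1 0))"
    by (simp_all add: structure_simps tensor_eq_def all_3' mul_traceless_def tr_def axis_def)
  then show "\<not> sep18 P3_7" "\<not> sep18 (P3_16 1)" "\<not> sep18 P3_20"
    unfolding sep18_def by blast+
qed (use br_parallel_separates sep18_def in blast)+

lemma not_sep20: "\<not> sep20 (P3_4 2)" "\<not> sep20 P3_5" "\<not> sep20 P3_7" "\<not> sep20 (P3_16 1)" "\<not> sep20 P3_18"
proof -
  have "\<not> tensor_eq (mul P3_7 (vec3 1 0 0) (vec3 1 0 0)) (mul P3_7 (vec3 0 1 0) (vec3 0 1 0))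
      (mul P3_7 (vec3 1 0 0) (vec3 0 1 0)) (mul P3_7 (vec3 1 0 0) (vec3 0 1 0))"
    "\<not> tensor_eq (mul (P3_16 1) (vec3 1 0 0) (vec3 0 1 0)) (mul (P3_16 1) (vec3 1 0 0) (vec3 0 1 0))
      (mul (P3_16 1) (vec3 1 0 0) (vec3 1 0 0)) (mul (P3_16 1) (vec3 0 1 0) (vec3 0 1 0))"
    "\<not> tensor_eq (mul P3_18 (vec3 1 0 0) (vec3 0 1 0)) (mul P3_18 (vec3 1 0 0) (vec3 0 1 0))
      (mul P3_18 (vec3 1 0 0) (vec3 1 0 0)) (mul P3_18 (vec3 0 1 0) (vec3 0 1 0))"
    by (simp_all add: structure_simps tensor_eq_def all_3')
  then show "\<not> sep20 P3_7" "\<not> sep20 (P3_16 1)" "\<not> sep20 P3_18"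
    unfolding sep20_def by blast+
qed (use br_parallel_separates sep20_def in blast)+

lemma zclosures_incomparable:
  "\<not> zclosure U4 \<subseteq> zclosure U5" "\<not> zclosure U4 \<subseteq> zclosure U7" "\<not> zclosure U4 \<subseteq> zclosure U16"
  "\<not> zclosure U4 \<subseteq> zclosure U18" "\<not> zclosure U4 \<subseteq> zclosure U20"
  "\<not> zclosure U5 \<subseteq> zclosure U4" "\<not> zclosure U5 \<subseteq> zclosure U7" "\<not> zclosure U5 \<subseteq> zclosure U16"
  "\<not> zclosure U5 \<subseteq> zclosure U18" "\<not> zclosure U5 \<subseteq> zclosure U20"
  "\<not> zclosure U7 \<subseteq> zclosure U4" "\<not> zclosure U7 \<subseteq> zclosure U5" "\<not> zclosure U7 \<subseteq> zclosure U16"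
  "\<not> zclosure U7 \<subseteq> zclosure U18" "\<not> zclosure U7 \<subseteq> zclosure U20"
  "\<not> zclosure U16 \<subseteq> zclosure U4" "\<not> zclosure U16 \<subseteq> zclosure U5" "\<not> zclosure U16 \<subseteq> zclosure U7"
  "\<not> zclosure U16 \<subseteq> zclosure U18" "\<not> zclosure U16 \<subseteq> zclosure U20"
  "\<not> zclosure U18 \<subseteq> zclosure U4" "\<not> zclosure U18 \<subseteq> zclosure U5" "\<not> zclosure U18 \<subseteq> zclosure U7"
  "\<not> zclosure U18 \<subseteq> zclosure U16" "\<not> zclosure U18 \<subseteq> zclosure U20"
  "\<not> zclosure U20 \<subseteq> zclosure U4" "\<not> zclosure U20 \<subseteq> zclosure U5" "\<not> zclosure U20 \<subseteq> zclosure U7"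
  "\<not> zclosure U20 \<subseteq> zclosure U16" "\<not> zclosure U20 \<subseteq> zclosure U18"
  using structures_in_zclosure(1)[of 2] structures_in_zclosure(2,3) structures_in_zclosure(4)[of 1]
    structures_in_zclosure(5,6) zclosure_U_sep not_sep4 not_sep5 not_sep7 not_sep16 not_sep18 not_sep20
  by (meson subsetD)+

text \<open>Tables are sums of conditionals whose tests do not involve the parameter.\<close>

lemma range_poly_if:
  "p \<in> range poly \<Longrightarrow> q \<in> range poly \<Longrightarrow>
    (\<lambda>t. if b then p t else q t) \<in> range (poly :: complex poly \<Rightarrow> _)"
  by (cases b) auto

lemmas range_poly_intros = range_poly_const range_poly_ident range_poly_if range_poly_add
  range_poly_diff range_poly_mult range_poly_power range_poly_uminus

lemma zirreducible_zclosures: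
  "zirreducible (zclosure U4)" "zirreducible (zclosure U5)" "zirreducible (zclosure U7)"
  "zirreducible (zclosure U16)" "zirreducible (zclosure U18)" "zirreducible (zclosure U20)"
proof -
  have "(\<lambda>\<alpha>. P3_4 \<alpha> s) \<in> range poly" for s
    unfolding P3_4_def mkstr_def asymtab_def symtab_def
    by (cases s) (simp only: prod.case list.map sum_list.Cons sum_list.Nil, intro range_poly_intros)
  then show "zirreducible (zclosure U4)" unfolding U4_def by (rule zirreducible_orbit_family)
  have "(\<lambda>\<alpha>. P3_16 \<alpha> s) \<in> range poly" for s
    unfolding P3_16_def mkstr_def asymtab_def symtab_def
    by (cases s) (simp only: prod.case list.map sum_list.Cons sum_list.Nil, intro range_poly_intros)
  then show "zirreducible (zclosure U16)" unfolding U16_def by (rule zirreducible_orbit_family)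
  \<comment> \<open>A single orbit is a constant family.\<close>
  have "zirreducible (zclosure (orbit c))" for c
    using zirreducible_orbit_family[of "\<lambda>_. c"] by simp
  then show "zirreducible (zclosure U5)" "zirreducible (zclosure U7)"
    "zirreducible (zclosure U18)" "zirreducible (zclosure U20)" unfolding U_defs by blast+
qed

lemma zclosures_subset_P3:
  "zclosure U4 \<subseteq> P3" "zclosure U5 \<subseteq> P3" "zclosure U7 \<subseteq> P3" "zclosure U16 \<subseteq> P3"
  "zclosure U18 \<subseteq> P3" "zclosure U20 \<subseteq> P3"
  unfolding U_defs using structures_poisson P3_orbit
  by (intro zclosure_minimal zclosed_P3; blast)+

section \<open>Degenerations\<close>

lemma zclosure_degeneration:
  assumes "\<And>s. (\<lambda>t. \<gamma> t s) \<in> range (poly :: complex poly \<Rightarrow> _)"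
    and "finite B" "\<And>t. t \<notin> B \<Longrightarrow> \<gamma> t \<in> zclosure U"
  shows "\<gamma> 0 \<in> zclosure U"
proof (rule zclosure_limit[OF assms(1)])
  show "finite {t. \<gamma> t \<notin> zclosure U}"
    by (rule finite_subset[OF _ assms(2)]) (use assms(3) in blast)
qed

text \<open>For \<open>p \<noteq> 0\<close> the line spanned by \<open>p e_2 + q e_3\<close> becomes
  the new \<open>e_2\<close> and \<open>e_3 / p\<close> the new \<open>e_3\<close>; the case
  \<open>p = 0\<close> is a limit.\<close>

lemma in_zclosure_U18:
  "mkstr [(0,0,0,1), (0,1,1,1), (0,2,2,1)] [(1,2,1,p), (1,2,2,q)] \<in> zclosure U18"
proof -
  let ?d = "\<lambda>p. mkstr [(0,0,0,1), (0,1,1,1), (0,2,2,1)] [(1,2,1,p), (1,2,2,q)]"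
  have generic: "?d (p + t) \<in> zclosure U18" if "t \<notin> {- p}" for t
  proof -
    have "P3_18 \<in> orbit (?d (p + t))"
      \<comment> \<open>A basis inside the fixed structure \<open>P3_18\<close>, showing the table
        \<open>?d (p + t)\<close>; \<open>orbit_sym\<close> then reverses the relation. The other
        degenerations proceed likewise.\<close>
      by (rule orbit_mkstrI[of "vec3 1 0 0" "vec3 0 1 (- q)" "vec3 0 0 (p + t)"])
        (use that in \<open>auto simp: det3_def structure_simps symtab_def asymtab_def vec_eq_3'
          add_eq_0_iff algebra_simps\<close>)
    then show ?thesis using orbit_sym zclosure_subset unfolding U18_def by blast
  qed
  have curve: "(\<lambda>t. ?d (p + t) s) \<in> range poly" for s
    unfolding mkstr_def symtab_def asymtab_def
    by (cases s; simp only: prod.case list.map sum_list.Cons sum_list.Nil; intro range_poly_intros)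
  have "?d (p + 0) \<in> zclosure U18"
    by (rule zclosure_degeneration[where \<gamma> = "\<lambda>t. ?d (p + t)" and B = "{- p}", OF curve]) (simp, rule generic)
  then show ?thesis by simp
qed

lemma in_zclosure_U20:
  "mkstr [(0,0,0,1)] [(1,2,1,p), (1,2,2,q)] \<in> zclosure U20"
proof -
  let ?d = "\<lambda>p. mkstr [(0,0,0,1)] [(1,2,1,p), (1,2,2,q)]"
  have generic: "?d (p + t) \<in> zclosure U20" if "t \<notin> {- p}" for t
  proof -
    have "P3_20 \<in> orbit (?d (p + t))"
      by (rule orbit_mkstrI[of "vec3 1 0 0" "vec3 0 1 (- q)" "vec3 0 0 (p + t)"])
        (use that in \<open>auto simp: det3_def structure_simps symtab_def asymtab_def vec_eq_3'
          add_eq_0_iff algebra_simps\<close>)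
    then show ?thesis using orbit_sym zclosure_subset unfolding U20_def by blast
  qed
  have curve: "(\<lambda>t. ?d (p + t) s) \<in> range poly" for s
    unfolding mkstr_def symtab_def asymtab_def
    by (cases s; simp only: prod.case list.map sum_list.Cons sum_list.Nil; intro range_poly_intros)
  have "?d (p + 0) \<in> zclosure U20"
    by (rule zclosure_degeneration[where \<gamma> = "\<lambda>t. ?d (p + t)" and B = "{- p}", OF curve]) (simp, rule generic)
  then show ?thesis by simp
qed

text \<open>Inside \<open>P3_20\<close> put \<open>X = t e_1 - k e_3\<close>,
  \<open>Y = t^2 e_1\<close>, \<open>Z = e_2\<close>. Then \<open>X X = Y\<close>,
  \<open>X Y = t Y\<close>, \<open>Y Y = t^2 Y\<close> and \<open>{X,Z} = k Z\<close>: the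
  idempotent direction turns nilpotent at \<open>t = 0\<close> while the bracket stays.\<close>

lemma nilpotent_in_zclosure_U20:
  assumes "k \<noteq> 0"
  shows "mkstr [(0,0,1,1)] [(0,2,2,k)] \<in> zclosure U20"
proof -
  let ?d = "\<lambda>t. mkstr [(0,0,1,1), (0,1,1,t), (1,1,1,t^2)] [(0,2,2,k)]"
  have generic: "?d t \<in> zclosure U20" if "t \<notin> {0}" for t
  proof -
    have "P3_20 \<in> orbit (?d t)"
      by (rule orbit_mkstrI[of "vec3 t 0 (- k)" "vec3 (t^2) 0 0" "vec3 0 1 0"])
        (use that assms in \<open>auto simp: det3_def structure_simps symtab_def asymtab_def vec_eq_3'
          power2_eq_square algebra_simps\<close>)
    then show ?thesis using orbit_sym zclosure_subset unfolding U20_def by blast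
  qed
  have curve: "(\<lambda>t. ?d t s) \<in> range poly" for s
    unfolding mkstr_def symtab_def asymtab_def
    by (cases s; simp only: prod.case list.map sum_list.Cons sum_list.Nil; intro range_poly_intros)
  have "?d 0 \<in> zclosure U20"
    by (rule zclosure_degeneration[where \<gamma> = "\<lambda>t. ?d t" and B = "{0}", OF curve]) (simp, rule generic)
  moreover have "?d 0 = mkstr [(0,0,1,1)] [(0,2,2,k)]"
    by (simp add: fun_eq_iff mkstr_def symtab_def)
  ultimately show ?thesis by simp
qed

text \<open>The product is the quadratic form \<open>x^2 + q z^2\<close>. For
  \<open>q = - c^2 \<noteq> 0\<close> it splits into the factors \<open>x + c z\<close> and
  \<open>x - c z\<close>, which gives the hyperbolic form of \<open>P3_16\<close>; the bracket then
  fixes the parameter \<open>- k / c\<close>.\<close>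

lemma in_zclosure_U16:
  "mkstr [(0,0,1,1), (2,2,1,q)] [(0,2,1,k)] \<in> zclosure U16"
proof -
  let ?d = "\<lambda>q. mkstr [(0,0,1,1), (2,2,1,q)] [(0,2,1,k)]"
  have generic: "?d (q + t) \<in> zclosure U16" if "t \<notin> {- q}" for t
  proof -
    define c where "c = csqrt (- (q + t))"
    have c: "q + t = - (c * c)" using power2_csqrt[of "- (q + t)"]
      unfolding c_def[symmetric] by (simp add: power2_eq_square)
    then have "c \<noteq> 0" using that by (auto simp: add_eq_0_iff2)
    have "P3_16 (- k / c) \<in> orbit (?d (q + t))"
      unfolding c
      by (rule orbit_mkstrI[of "vec3 1 1 0" "vec3 0 0 2" "vec3 c (- c) 0"])
        (use \<open>c \<noteq> 0\<close> in \<open>auto simp: det3_def structure_simps symtab_def asymtab_def vec_eq_3'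
          algebra_simps\<close>)
    from orbit_sym[OF this] have "?d (q + t) \<in> U16" unfolding U16_def by blast
    then show ?thesis by (rule subsetD[OF zclosure_subset])
  qed
  have curve: "(\<lambda>t. ?d (q + t) s) \<in> range poly" for s
    unfolding mkstr_def symtab_def asymtab_def
    by (cases s; simp only: prod.case list.map sum_list.Cons sum_list.Nil; intro range_poly_intros)
  have "?d (q + 0) \<in> zclosure U16"
    by (rule zclosure_degeneration[where \<gamma> = "\<lambda>t. ?d (q + t)" and B = "{- q}", OF curve]) (simp, rule generic)
  then show ?thesis by simp
qed

text \<open>\<open>ad e_1\<close> is upper triangular on the span of \<open>e_2\<close>,
  \<open>e_3\<close> with diagonal \<open>l\<close>, \<open>m\<close>. If
  \<open>l \<noteq> m\<close> it is diagonalisable, and if \<open>l \<noteq> 0\<close> rescaling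
  \<open>e_1\<close> makes the first eigenvalue 1.\<close>

lemma in_zclosure_U4:
  "mkstr [] [(0,1,1,l), (0,2,2,m), (0,2,1,n)] \<in> zclosure U4"
proof -
  let ?d = "\<lambda>l. mkstr [] [(0,1,1,l), (0,2,2,m), (0,2,1,n)]"
  have generic: "?d (l + t) \<in> zclosure U4" if "t \<notin> {- l, m - l}" for t
  proof -
    have ne: "l + t \<noteq> 0" "l + t - m \<noteq> 0" using that by (auto simp: add_eq_0_iff algebra_simps)
    define l' where "l' = l + t"
    have "P3_4 (m / l') \<in> orbit (?d l')"
      by (rule orbit_mkstrI[of "vec3 l' 0 0" "vec3 0 1 0" "vec3 0 (n / (l' - m)) 1"])
        (use ne[folded l'_def] in \<open>auto simp: det3_def structure_simps symtab_def asymtab_def vec_eq_3'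
          field_simps\<close>)
    from orbit_sym[OF this] have "?d l' \<in> U4" unfolding U4_def by blast
    then show ?thesis unfolding l'_def by (rule subsetD[OF zclosure_subset])
  qed
  have curve: "(\<lambda>t. ?d (l + t) s) \<in> range poly" for s
    unfolding mkstr_def symtab_def asymtab_def
    by (cases s; simp only: prod.case list.map sum_list.Cons sum_list.Nil; intro range_poly_intros)
  have "?d (l + 0) \<in> zclosure U4"
    by (rule zclosure_degeneration[where \<gamma> = "\<lambda>t. ?d (l + t)" and B = "{- l, m - l}", OF curve]) (simp, rule generic)
  then show ?thesis by simp
qed

text \<open>The algebra \<open>C[X] / (X (X - b))\<close> with unit \<open>e_1\<close> and
  \<open>X = e_2\<close>, plus a line with \<open>e_3 e_3 = c e_3\<close>. For nonzero
  \<open>b\<close>, \<open>c\<close> these are three copies of the field; the two parameters are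
  specialised one at a time.\<close>

lemma decomposable_in_zclosure_U7:
  "mkstr [(0,0,0,1), (0,1,1,1), (1,1,1,b), (2,2,2,c)] [] \<in> zclosure U7"
proof -
  let ?d = "\<lambda>b c. mkstr [(0,0,0,1), (0,1,1,1), (1,1,1,b), (2,2,2,c)] []"
  have generic: "?d (b + t) (c + u) \<in> zclosure U7" if "t \<notin> {- b}" "u \<notin> {- c}" for t u
  proof -
    have det: "det3 (vec3 1 1 0) (vec3 (b + t) 0 0) (vec3 0 0 (c + u)) \<noteq> 0"
      using that by (simp add: det3_def add_eq_0_iff)
    have "P3_7 \<in> orbit (?d (b + t) (c + u))"
      by (rule orbit_mkstrI[OF det])
        (auto simp: structure_simps symtab_def asymtab_def vec_eq_3' algebra_simps)
    then show ?thesis using orbit_sym zclosure_subset unfolding U7_def by blast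
  qed
  have curve2: "(\<lambda>t. ?d b (c + t) s) \<in> range poly" for b s
    unfolding mkstr_def symtab_def asymtab_def
    by (cases s; simp only: prod.case list.map sum_list.Cons sum_list.Nil; intro range_poly_intros)
  have curve1: "(\<lambda>t. ?d (b + t) c s) \<in> range poly" for c s
    unfolding mkstr_def symtab_def asymtab_def
    by (cases s; simp only: prod.case list.map sum_list.Cons sum_list.Nil; intro range_poly_intros)
  have "?d (b + t) (c + 0) \<in> zclosure U7" if "t \<notin> {- b}" for t
    by (rule zclosure_degeneration[where \<gamma> = "\<lambda>u. ?d (b + t) (c + u)" and B = "{- c}", OF curve2])
      (simp, rule generic[OF that])
  then have "?d (b + 0) (c + 0) \<in> zclosure U7"
    by (intro zclosure_degeneration[where \<gamma> = "\<lambda>t. ?d (b + t) (c + 0)" and B = "{- b}", OF curve1]) simp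
  then show ?thesis by simp
qed

text \<open>The table of \<open>x C[x] / (x (x - r1) (x - r2) (x - r3))\<close> in the basis
  \<open>x\<close>, \<open>x (x - r1)\<close>, \<open>x (x - r1) (x - r2)\<close>; evaluation at the roots is an isomorphism onto
  three copies of the field when the roots are distinct and nonzero.\<close>

definition roots_structure :: "complex \<Rightarrow> complex \<Rightarrow> complex \<Rightarrow> pt" where
  "roots_structure r1 r2 r3 = mkstr [(0,0,1,1), (0,0,0,r1), (0,1,2,1), (0,1,1,r2), (0,2,2,r3),
     (1,1,2,r3 - r1 + r2), (1,1,1,r2 * (r2 - r1)), (1,2,2,r3 * (r3 - r1)),
     (2,2,2,r3 * (r3 - r1) * (r3 - r2))] []"

text \<open>The roots are specialised in the order \<open>r3\<close>, \<open>r2\<close>,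
  \<open>r1\<close>: each move needs only the earlier roots to be generic, so only finitely many
  values are bad.\<close>

lemma roots_structure_in_zclosure_U7: "roots_structure r1 r2 r3 \<in> zclosure U7"
proof -
  have 1: "roots_structure r1 r2 r3 \<in> zclosure U7"
    if "r1 \<noteq> 0" "r2 \<noteq> 0" "r3 \<noteq> 0" "r2 \<noteq> r1" "r3 \<noteq> r1" "r3 \<noteq> r2" for r1 r2 r3
  proof -
    \<comment> \<open>Each vector lists the values of one basis polynomial at \<open>r1\<close>,
      \<open>r2\<close>, \<open>r3\<close>.\<close>
    have det: "det3 (vec3 r1 r2 r3) (vec3 0 (r2 * (r2 - r1)) (r3 * (r3 - r1)))
          (vec3 0 0 (r3 * (r3 - r1) * (r3 - r2))) \<noteq> 0"
      using that by (simp add: det3_def)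
    have "P3_7 \<in> orbit (roots_structure r1 r2 r3)"
      unfolding roots_structure_def
      by (rule orbit_mkstrI[OF det])
        (auto simp: structure_simps symtab_def asymtab_def vec_eq_3' algebra_simps)
    then show ?thesis using orbit_sym zclosure_subset unfolding U7_def by blast
  qed
  have curves: "(\<lambda>t. roots_structure (r1 + t) r2 r3 s) \<in> range poly"
    "(\<lambda>t. roots_structure r1 (r2 + t) r3 s) \<in> range poly"
    "(\<lambda>t. roots_structure r1 r2 (r3 + t) s) \<in> range poly" for r1 r2 r3 s
    unfolding roots_structure_def mkstr_def symtab_def asymtab_def
    by (cases s; simp only: prod.case list.map sum_list.Cons sum_list.Nil; intro range_poly_intros)+
  have 2: "roots_structure r1 r2 r3 \<in> zclosure U7" if "r1 \<noteq> 0" "r2 \<noteq> 0" "r2 \<noteq> r1" for r1 r2 r3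
  proof -
    have "roots_structure r1 r2 (r3 + t) \<in> zclosure U7" if "t \<notin> {- r3, r1 - r3, r2 - r3}" for t
      by (rule 1) (use \<open>r1 \<noteq> 0\<close> \<open>r2 \<noteq> 0\<close> \<open>r2 \<noteq> r1\<close> that in \<open>auto simp: add_eq_0_iff\<close>)
    from zclosure_degeneration[where \<gamma> = "\<lambda>t. roots_structure r1 r2 (r3 + t)" and B = "{- r3, r1 - r3, r2 - r3}", OF curves(3)] this
    show ?thesis by simp
  qed
  have 3: "roots_structure r1 r2 r3 \<in> zclosure U7" if "r1 \<noteq> 0" for r1 r2 r3
  proof -
    have "roots_structure r1 (r2 + t) r3 \<in> zclosure U7" if "t \<notin> {- r2, r1 - r2}" for t
      by (rule 2) (use \<open>r1 \<noteq> 0\<close> that in \<open>auto simp: add_eq_0_iff\<close>)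
    from zclosure_degeneration[where \<gamma> = "\<lambda>t. roots_structure r1 (r2 + t) r3" and B = "{- r2, r1 - r2}", OF curves(2)] this
    show ?thesis by simp
  qed
  have "roots_structure (r1 + t) r2 r3 \<in> zclosure U7" if "t \<notin> {- r1}" for t
    by (rule 3) (use that in \<open>auto simp: add_eq_0_iff\<close>)
  from zclosure_degeneration[where \<gamma> = "\<lambda>t. roots_structure (r1 + t) r2 r3" and B = "{- r1}", OF curves(1)] this
  show ?thesis by simp
qed

text \<open>A symmetric matrix defines a unimodular Lie bracket: the rows are the brackets of
  \<open>(e_1, e_2)\<close>, \<open>(e_2, e_0)\<close> and \<open>(e_0, e_1)\<close>.\<close>

definition sym_structure :: "complex \<Rightarrow> complex \<Rightarrow> complex \<Rightarrow> complex \<Rightarrow> complex \<Rightarrow> complex \<Rightarrow> pt" where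
  "sym_structure m00 m01 m02 m11 m12 m22 = mkstr [] [(1,2,0,m00), (1,2,1,m01), (1,2,2,m02),
     (2,0,0,m01), (2,0,1,m11), (2,0,2,m12), (0,1,0,m02), (0,1,1,m12), (0,1,2,m22)]"

lemma mul_sym_structure: "mul (sym_structure m00 m01 m02 m11 m12 m22) x y = 0"
  by (simp add: vec_eq_3' bil_nth sym_structure_def mkstr_def symtab_def)

lemma br_cross_structure: "br (sym_structure 1 0 0 1 0 1) x y =
   vec3 (x$1 * y$2 - x$2 * y$1) (x$2 * y$0 - x$0 * y$2) (x$0 * y$1 - x$1 * y$0)"
  by (simp add: vec_eq_3' bil_nth sym_structure_def mkstr_def asymtab_def algebra_simps)

text \<open>If the matrix is \<open>Q Q\<^sup>T\<close> with \<open>Q\<close> upper triangular with rows \<open>(a,b,c)\<close>, \<open>(0,d,e)\<close>, \<open>(0,0,f)\<close>,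
  then the rows of the cofactor matrix of \<open>Q\<close> form a basis realising it inside the cross product.\<close>

lemma sym_structure_in_zclosure_U5: "sym_structure m00 m01 m02 m11 m12 m22 \<in> zclosure U5"
proof -
  have "P3_5 \<in> orbit (sym_structure 1 0 0 1 0 1)"
    unfolding sym_structure_def
    \<comment> \<open>\<open>P3_5\<close> is \<open>sl_2\<close> with \<open>e\<close>,
      \<open>f\<close>, \<open>h\<close> equal to \<open>e_1\<close>, \<open>e_2\<close>,
      \<open>e_3\<close>; the vectors \<open>i (e + f) / 2\<close>, \<open>(e - f) / 2\<close>,
      \<open>- i h / 2\<close> multiply like the cross product.\<close>
    by (rule orbit_mkstrI[of "vec3 (\<i>/2) (\<i>/2) 0" "vec3 (1/2) (-1/2) 0" "vec3 0 0 (-\<i>/2)"])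
      (auto simp: det3_def structure_simps symtab_def asymtab_def vec_eq_3' algebra_simps)
  then have U5: "sym_structure 1 0 0 1 0 1 \<in> U5" unfolding U5_def by (rule orbit_sym)
  \<comment> \<open>The three quantities are the pivots of symmetric elimination from the lower
    right corner; their square roots \<open>f\<close>, \<open>d\<close>, \<open>a\<close> are the
    diagonal of \<open>Q\<close>.\<close>
  have 1: "sym_structure m00 m01 m02 m11 m12 m22 \<in> zclosure U5"
    if m: "m22 \<noteq> 0" "m11 - (m12 * m12) / m22 \<noteq> 0"
      "m00 - (m02 * m02) / m22 - (m01 - m02 * m12 / m22)^2 / (m11 - (m12 * m12) / m22) \<noteq> 0"
    for m00 m01 m02 m11 m12 m22
  proof -
    have root: "\<exists>z. z * z = w" for w :: complex by (metis power2_csqrt power2_eq_square)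
    obtain f where f: "f * f = m22" using root by blast
    obtain d where d: "d * d = m11 - (m12 * m12) / m22" using root by blast
    obtain a where a: "a * a = m00 - (m02 * m02) / m22
        - (m01 - m02 * m12 / m22)^2 / (m11 - (m12 * m12) / m22)" using root by blast
    have ne: "a \<noteq> 0" "d \<noteq> 0" "f \<noteq> 0" using m a d f by auto
    define e where "e = m12 / f"
    define c where "c = m02 / f"
    define b where "b = (m01 - c * e) / d"
    have M: "m22 = f * f" "m12 = e * f" "m02 = c * f" using ne f by (simp_all add: e_def c_def)
    have "e * e = m12 * m12 / m22" "c * c = m02 * m02 / m22" "c * e = m02 * m12 / m22"
      using ne by (simp_all add: M)
    then have M': "m11 = d * d + e * e" "m01 = b * d + c * e" "m00 = a * a + b * b + c * c"
      using ne a d by (simp_all add: b_def power2_eq_square)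
    have det: "det3 (vec3 (d * f) 0 0) (vec3 (- f * b) (f * a) 0)
        (vec3 (b * e - c * d) (- a * e) (a * d)) \<noteq> 0"
      using ne by (simp add: det3_def)
    have "sym_structure 1 0 0 1 0 1 \<in> orbit (sym_structure m00 m01 m02 m11 m12 m22)"
      unfolding M M' sym_structure_def[of "a * a + b * b + c * c"]
      by (rule orbit_mkstrI[OF det])
        (auto simp: br_cross_structure mul_sym_structure symtab_def asymtab_def vec_eq_3'
          algebra_simps)
    then show ?thesis using orbit_sym U_orbit(2) U5 zclosure_subset by blast
  qed
  have curves: "(\<lambda>t. sym_structure (m00 + t) m01 m02 m11 m12 m22 s) \<in> range poly"
    "(\<lambda>t. sym_structure m00 m01 m02 (m11 + t) m12 m22 s) \<in> range poly"
    "(\<lambda>t. sym_structure m00 m01 m02 m11 m12 (m22 + t) s) \<in> range poly" for m00 m01 m02 m11 m12 m22 s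
    unfolding sym_structure_def mkstr_def symtab_def asymtab_def
    by (cases s; simp only: prod.case list.map sum_list.Cons sum_list.Nil; intro range_poly_intros)+
  \<comment> \<open>Each pivot condition is removed by moving its diagonal entry, which shifts that
    pivot by \<open>t\<close> and leaves the pivots below it unchanged.\<close>
  have 2: "sym_structure m00 m01 m02 m11 m12 m22 \<in> zclosure U5"
    if m: "m22 \<noteq> 0" "m11 - (m12 * m12) / m22 \<noteq> 0" for m00 m01 m02 m11 m12 m22
  proof -
    define D where "D = m00 - (m02 * m02) / m22
        - (m01 - m02 * m12 / m22)^2 / (m11 - (m12 * m12) / m22)"
    have "sym_structure (m00 + t) m01 m02 m11 m12 m22 \<in> zclosure U5" if "t \<notin> {- D}" for t
    proof (rule 1[OF m])
      have e: "(m00 + t) - (m02 * m02) / m22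
        - (m01 - m02 * m12 / m22)^2 / (m11 - (m12 * m12) / m22) = D + t" by (simp add: D_def)
      show "(m00 + t) - (m02 * m02) / m22
        - (m01 - m02 * m12 / m22)^2 / (m11 - (m12 * m12) / m22) \<noteq> 0"
        unfolding e using that by (auto simp: add_eq_0_iff)
    qed
    from zclosure_degeneration[where \<gamma> = "\<lambda>t. sym_structure (m00 + t) m01 m02 m11 m12 m22" and B = "{- D}", OF curves(1)] this
    show ?thesis by simp
  qed
  have 3: "sym_structure m00 m01 m02 m11 m12 m22 \<in> zclosure U5"
    if m: "m22 \<noteq> 0" for m00 m01 m02 m11 m12 m22
  proof -
    have "sym_structure m00 m01 m02 (m11 + t) m12 m22 \<in> zclosure U5"
      if "t \<notin> {(m12 * m12) / m22 - m11}" for t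
      by (rule 2[OF m]) (use that in \<open>auto simp: algebra_simps\<close>)
    from zclosure_degeneration[where \<gamma> = "\<lambda>t. sym_structure m00 m01 m02 (m11 + t) m12 m22" and B = "{(m12 * m12) / m22 - m11}", OF curves(2)] this
    show ?thesis by simp
  qed
  have "sym_structure m00 m01 m02 m11 m12 (m22 + t) \<in> zclosure U5" if "t \<notin> {- m22}" for t
    by (rule 3) (use that in \<open>auto simp: add_eq_0_iff\<close>)
  from zclosure_degeneration[where \<gamma> = "\<lambda>t. sym_structure m00 m01 m02 m11 m12 (m22 + t)" and B = "{- m22}", OF curves(3)] this
  show ?thesis by simp
qed

section \<open>Every Poisson algebra lies in one of the six closures\<close>

lemma zclosure_U_orbit:
  assumes "c \<in> orbit d"
  shows "d \<in> zclosure U4 \<Longrightarrow> c \<in> zclosure U4" "d \<in> zclosure U5 \<Longrightarrow> c \<in> zclosure U5"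
    "d \<in> zclosure U7 \<Longrightarrow> c \<in> zclosure U7" "d \<in> zclosure U16 \<Longrightarrow> c \<in> zclosure U16"
    "d \<in> zclosure U18 \<Longrightarrow> c \<in> zclosure U18" "d \<in> zclosure U20 \<Longrightarrow> c \<in> zclosure U20"
proof -
  have stable: "d \<in> zclosure U \<Longrightarrow> c \<in> zclosure U"
    if "\<And>c d. c \<in> U \<Longrightarrow> d \<in> orbit c \<Longrightarrow> d \<in> U" for U
    using zclosure_orbit_stable[OF that _ assms] .
  show "d \<in> zclosure U4 \<Longrightarrow> c \<in> zclosure U4" by (rule stable, rule U_orbit(1), assumption+)
  show "d \<in> zclosure U5 \<Longrightarrow> c \<in> zclosure U5" by (rule stable, rule U_orbit(2), assumption+)
  show "d \<in> zclosure U7 \<Longrightarrow> c \<in> zclosure U7" by (rule stable, rule U_orbit(3), assumption+)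
  show "d \<in> zclosure U16 \<Longrightarrow> c \<in> zclosure U16" by (rule stable, rule U_orbit(4), assumption+)
  show "d \<in> zclosure U18 \<Longrightarrow> c \<in> zclosure U18" by (rule stable, rule U_orbit(5), assumption+)
  show "d \<in> zclosure U20 \<Longrightarrow> c \<in> zclosure U20" by (rule stable, rule U_orbit(6), assumption+)
qed

lemma quadratic_roots:
  fixes s p :: complex
  obtains u v where "u + v = s" "u * v = p"
proof
  define D where "D = csqrt (s\<^sup>2 - 4 * p)"
  have D: "D * D = s * s - 4 * p"
    using power2_csqrt[of "s\<^sup>2 - 4 * p"] unfolding D_def[symmetric] by (simp add: power2_eq_square)
  show "(s + D) / 2 + (s - D) / 2 = s" by (simp add: field_simps)
  show "(s + D) / 2 * ((s - D) / 2) = p" using D by (simp add: field_simps)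
qed

text \<open>Vieta's formulas for \<open>X^3 - g X^2 - b X - a\<close>, the form in which the
  relation of a generator arises.\<close>

lemma cubic_roots:
  fixes a b g :: complex
  obtains r1 r2 r3 where "g = r1 + r2 + r3" "b = - (r1 * r2 + r1 * r3 + r2 * r3)" "a = r1 * r2 * r3"
proof -
  obtain r1 where r1: "poly [:- a, - b, - g, 1:] r1 = 0"
    using alg_closed_imp_poly_has_root[of "[:- a, - b, - g, 1:]"] by auto
  obtain r2 r3 where r: "r2 + r3 = g - r1" "r2 * r3 = r1 * r1 - g * r1 - b"
    by (rule quadratic_roots)
  have "a = r1 * (r2 * r3)" unfolding r(2) using r1 by (simp add: algebra_simps)
  moreover have "r1 * r2 + r1 * r3 + r2 * r3 = r1 * (r2 + r3) + r2 * r3" by (simp add: algebra_simps)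
  ultimately show ?thesis using that[of r1 r2 r3] r by (simp add: algebra_simps)
qed

lemma cubic_nonroot:
  fixes p q r :: complex
  obtains l where "l * l * l + p * (l * l) + q * l + r \<noteq> 0"
proof -
  have "[:r, q, p, 1:] \<noteq> 0" by simp
  then obtain l where "poly [:r, q, p, 1:] l \<noteq> 0" by (metis poly_all_0_iff_0)
  then show ?thesis using that[of l] by (simp add: algebra_simps)
qed

lemma det3_zero_third:
  assumes "det3 x y z \<noteq> 0" "det3 x y w = 0"
  obtains a b where "w = a *s x + b *s y"
proof -
  obtain a b c where w: "w = a *s x + b *s y + c *s z" using det3_span[OF assms(1)] .
  have "det3 x y w = c * det3 x y z" unfolding w by (simp add: det3_def algebra_simps)
  then have "c = 0" using assms by simp
  then show ?thesis using that w by simp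
qed

section \<open>Structure of a single Poisson algebra\<close>

locale poisson_algebra =
  fixes c :: pt
  assumes poisson: "is_poisson c"
begin

abbreviation pm :: "complex^3 \<Rightarrow> complex^3 \<Rightarrow> complex^3"  (infixl "\<odot>" 70)
  where "x \<odot> y \<equiv> mul c x y"

abbreviation bk :: "complex^3 \<Rightarrow> complex^3 \<Rightarrow> complex^3"
  where "bk x y \<equiv> br c x y"

lemma comm: "x \<odot> y = y \<odot> x"
  using poisson unfolding is_poisson_def by blast

lemma assoc: "x \<odot> y \<odot> z = x \<odot> (y \<odot> z)"
  using poisson unfolding is_poisson_def by blast

lemma alt [simp]: "bk x x = 0"
  using poisson unfolding is_poisson_def by blast

lemma jacobi: "bk x (bk y z) + bk y (bk z x) + bk z (bk x y) = 0"
  using poisson unfolding is_poisson_def by blast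

lemma leibniz: "bk (x \<odot> y) z = bk x z \<odot> y + x \<odot> bk y z"
  using poisson unfolding is_poisson_def by blast

lemma anti: "bk x y = - bk y x"
  using alt[of "x + y"] by (simp only: bil_simps alt) (simp add: eq_neg_iff_add_eq_0 add.commute)

lemma table_orbit:
  assumes "det3 x y z \<noteq> 0"
    and
      "x \<odot> x = symtab M 0 0 0 *s x + symtab M 0 0 1 *s y + symtab M 0 0 2 *s z"
      "x \<odot> y = symtab M 0 1 0 *s x + symtab M 0 1 1 *s y + symtab M 0 1 2 *s z"
      "x \<odot> z = symtab M 0 2 0 *s x + symtab M 0 2 1 *s y + symtab M 0 2 2 *s z"
      "y \<odot> y = symtab M 1 1 0 *s x + symtab M 1 1 1 *s y + symtab M 1 1 2 *s z"
      "y \<odot> z = symtab M 1 2 0 *s x + symtab M 1 2 1 *s y + symtab M 1 2 2 *s z"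
      "z \<odot> z = symtab M 2 2 0 *s x + symtab M 2 2 1 *s y + symtab M 2 2 2 *s z"
      "bk x y = asymtab B 0 1 0 *s x + asymtab B 0 1 1 *s y + asymtab B 0 1 2 *s z"
      "bk x z = asymtab B 0 2 0 *s x + asymtab B 0 2 1 *s y + asymtab B 0 2 2 *s z"
      "bk y z = asymtab B 1 2 0 *s x + asymtab B 1 2 1 *s y + asymtab B 1 2 2 *s z"
  shows "c \<in> orbit (mkstr M B)"
  by (rule orbit_mkstrI) (fact assms comm alt)+

lemma monogenic:
  assumes det: "det3 x (x \<odot> x) (x \<odot> (x \<odot> x)) \<noteq> 0"
  shows "c \<in> zclosure U7"
proof -
  define y where "y = x \<odot> x"
  define z where "z = x \<odot> y"
  have det: "det3 x y z \<noteq> 0" using det by (simp add: y_def z_def)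
  obtain a b g where xz: "x \<odot> z = a *s x + b *s y + g *s z" using det3_span[OF det] .
  obtain r1 r2 r3 where r: "g = r1 + r2 + r3" "b = - (r1 * r2 + r1 * r3 + r2 * r3)" "a = r1 * r2 * r3"
    by (rule cubic_roots)
  have xx: "x \<odot> x = y" and xy: "x \<odot> y = z" and yx: "y \<odot> x = z"
    by (simp_all add: y_def z_def comm)
  have zx: "z \<odot> x = x \<odot> z" and zy: "z \<odot> y = y \<odot> z" by (rule comm)+
  have yy: "y \<odot> y = x \<odot> z" using assoc[of x x y] by (simp add: xx xy)
  have yz: "y \<odot> z = x \<odot> (x \<odot> z)" using assoc[of x x z] by (simp add: xx)
  have zz: "z \<odot> z = x \<odot> (x \<odot> (x \<odot> z))" using assoc[of x y z] by (simp add: xy yz)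
  note prods = xx xy yx zx zy yy yz zz xz bil_simps r
  \<comment> \<open>By Leibniz \<open>x\<close> commutes with its powers, so the bracket vanishes on
    the whole basis.\<close>
  have xy0: "bk x y = 0" using leibniz[of x x x] anti[of x y] by (simp add: y_def)
  have xz0: "bk x z = 0" using leibniz[of x y x] anti[of x z] xy0 anti[of y x] by (simp add: z_def)
  have yz0: "bk y z = 0" using leibniz[of x y y] anti[of y z] xy0 by (simp add: z_def)
  \<comment> \<open>The Newton basis: \<open>x (x - r1)\<close> and
    \<open>x (x - r1) (x - r2)\<close>.\<close>
  define f1 where "f1 = y - r1 *s x"
  define f2 where "f2 = z - (r1 + r2) *s y + (r1 * r2) *s x"
  have det': "det3 x f1 f2 \<noteq> 0"
  proof -
    have "det3 x f1 f2 = det3 x y z" by (simp add: det3_def f1_def f2_def algebra_simps)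
    then show ?thesis using det by simp
  qed
  have "c \<in> orbit (roots_structure r1 r2 r3)"
    unfolding roots_structure_def
  proof (rule table_orbit[OF det'])
    show "bk x f1 = asymtab [] 0 1 0 *s x + asymtab [] 0 1 1 *s f1 + asymtab [] 0 1 2 *s f2"
      "bk x f2 = asymtab [] 0 2 0 *s x + asymtab [] 0 2 1 *s f1 + asymtab [] 0 2 2 *s f2"
      "bk f1 f2 = asymtab [] 1 2 0 *s x + asymtab [] 1 2 1 *s f1 + asymtab [] 1 2 2 *s f2"
      by (simp_all add: asymtab_def f1_def f2_def bil_simps xy0 xz0 yz0 anti[of y x])
  qed (simp add: symtab_def f1_def f2_def prods; simp add: vec_eq_iff algebra_simps)+
  then show ?thesis using zclosure_U_orbit(3) roots_structure_in_zclosure_U7 by blast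
qed

text \<open>Comparing the squares of \<open>u + w\<close> and \<open>u - w\<close> forces
  \<open>p = l + m\<close>, \<open>q = l - m\<close>, so \<open>u w = (m u + l w) / 2\<close>.
  Associativity of \<open>u u w\<close> and \<open>u w w\<close> then yields
  \<open>l^2 = m^2 = 0\<close>.\<close>

lemma square_zero_pair:
  assumes ind: "\<And>a b. a *s u + b *s w = 0 \<Longrightarrow> a = 0 \<and> b = 0"
    and uu: "u \<odot> u = l *s u" and ww: "w \<odot> w = m *s w"
    and p: "(u + w) \<odot> (u + w) = p *s (u + w)" and q: "(u - w) \<odot> (u - w) = q *s (u - w)"
  shows "u \<odot> u = 0" "u \<odot> w = 0" "w \<odot> w = 0"
proof -
  have p': "l *s u + 2 *s (u \<odot> w) + m *s w = p *s (u + w)"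
    using p by (simp add: bil_simps uu ww comm[of w u] vec_eq_iff algebra_simps)
  have q': "l *s u - 2 *s (u \<odot> w) + m *s w = q *s (u - w)"
    using q by (simp add: bil_simps uu ww comm[of w u] vec_eq_iff algebra_simps)
  have "(2 * l - (p + q)) *s u + (2 * m - (p - q)) *s w
      = (l *s u + 2 *s (u \<odot> w) + m *s w - p *s (u + w)) + (l *s u - 2 *s (u \<odot> w) + m *s w - q *s (u - w))"
    by (simp add: vec_eq_iff algebra_simps)
  also have "\<dots> = 0" unfolding p' q' by simp
  finally have "2 * l - (p + q) = 0" "2 * m - (p - q) = 0" using ind by blast+
  then have pq: "p = l + m" "q = l - m" by algebra+
  have uw: "u \<odot> w = (m / 2) *s u + (l / 2) *s w"
    using p' unfolding pq by (simp add: vec_eq_iff field_simps)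
  have "l *s (u \<odot> w) = u \<odot> (u \<odot> w)" using assoc[of u u w] by (simp add: uu bil_simps)
  moreover have "(- (l * m)) *s u + (l * l) *s w = 4 *s (l *s (u \<odot> w) - u \<odot> (u \<odot> w))"
    unfolding uw bil_simps uu unfolding uw by (simp add: vec_eq_iff field_simps)
  ultimately have "(- (l * m)) *s u + (l * l) *s w = 0" by simp
  then have l: "l = 0" using ind mult_eq_0_iff by blast
  have "m *s (u \<odot> w) = w \<odot> (u \<odot> w)" using assoc[of u w w] by (simp add: ww bil_simps comm)
  moreover have "(m * m) *s u + (- (l * m)) *s w = 4 *s (m *s (u \<odot> w) - w \<odot> (u \<odot> w))"
    unfolding uw bil_simps ww comm[of w u] unfolding uw by (simp add: vec_eq_iff field_simps)
  ultimately have "(m * m) *s u + (- (l * m)) *s w = 0" by simp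
  then have m: "m = 0" using ind mult_eq_0_iff by blast
  show "u \<odot> u = 0" "u \<odot> w = 0" "w \<odot> w = 0" by (simp_all add: uu uw ww l m)
qed

lemma mul_zero_if_squares_parallel:
  assumes sq: "\<And>x. \<exists>a. x \<odot> x = a *s x"
  shows "x \<odot> y = 0"
proof -
  have sq0: "u \<odot> u = 0" for u
  proof (cases "u = 0")
    case False
    then obtain w z where det: "det3 u w z \<noteq> 0" by (rule det3_extend)
    obtain l m p q where "u \<odot> u = l *s u" "w \<odot> w = m *s w" "(u + w) \<odot> (u + w) = p *s (u + w)"
      "(u - w) \<odot> (u - w) = q *s (u - w)" using sq by metis
    moreover have "a = 0 \<and> b = 0" if "a *s u + b *s w = 0" for a b
      using det3_eq_0[OF det, of a b 0] that by simp
    ultimately show ?thesis by (rule square_zero_pair(1)[rotated])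
  qed simp
  have "2 *s (x \<odot> y) = (x + y) \<odot> (x + y) - x \<odot> x - y \<odot> y"
    by (simp add: bil_simps comm[of y x] vec_eq_iff)
  then show ?thesis by (simp add: sq0)
qed

section \<open>Algebras without a generator\<close>

context
  assumes nonmonogenic: "\<And>x. det3 x (x \<odot> x) (x \<odot> (x \<odot> x)) = 0"
begin

text \<open>Every element is quadratic over the unit. Completing squares gives \<open>U\<close>,
  \<open>W\<close> whose products are all multiples of \<open>e\<close>; associativity kills them,
  and Leibniz on \<open>U U = 0\<close> kills the \<open>e\<close>-part of
  \<open>{U,W}\<close>.\<close>

lemma idempotent_unit:
  assumes det: "det3 e u w \<noteq> 0" and unit: "\<And>v. e \<odot> v = v" and central: "\<And>x. bk e x = 0"
  shows "c \<in> zclosure U18"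
proof -
  have unit': "v \<odot> e = v" for v by (simp add: comm[of v] unit)
  have nm: "det3 e y (y \<odot> y) = 0" for y
  proof (rule ccontr)
    assume d: "det3 e y (y \<odot> y) \<noteq> 0"
    obtain a b g where y3: "y \<odot> (y \<odot> y) = a *s e + b *s y + g *s (y \<odot> y)" using det3_span[OF d] .
    \<comment> \<open>The cubic is the norm of \<open>x = l e + y\<close>: the powers of
      \<open>x\<close> in question are \<open>x\<close> times the basis \<open>e\<close>,
      \<open>x\<close>, \<open>x x\<close>.\<close>
    obtain l where l: "l * l * l + g * (l * l) + (- b) * l + a \<noteq> 0" by (rule cubic_nonroot)
    define x where "x = l *s e + 1 *s y + 0 *s (y \<odot> y)"
    have xx: "x \<odot> x = (l * l) *s e + (2 * l) *s y + 1 *s (y \<odot> y)"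
      by (simp add: x_def bil_simps unit unit' vec_eq_iff algebra_simps)
    have xxx: "x \<odot> (x \<odot> x) = (l * l * l + a) *s e + (3 * l * l + b) *s y + (3 * l + g) *s (y \<odot> y)"
      unfolding xx by (simp add: x_def bil_simps unit unit' y3 vec_eq_iff algebra_simps)
    have "det3 x (x \<odot> x) (x \<odot> (x \<odot> x)) = (l * l * l + g * (l * l) + (- b) * l + a) * det3 e y (y \<odot> y)"
      by (subst xxx, subst xx, subst x_def, subst det3_lincomb) (simp add: algebra_simps)
    then show False using nonmonogenic d l by simp
  qed
  have shift: "\<exists>b a. (v - b *s e) \<odot> (v - b *s e) = a *s e" if dz: "det3 e v z \<noteq> 0" for v z
  proof -
    obtain a b where vv: "v \<odot> v = a *s e + b *s v" using det3_zero_third[OF dz nm] .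
    have "(v - (b/2) *s e) \<odot> (v - (b/2) *s e) = (a + b * b / 4) *s e"
      by (simp add: bil_simps unit unit' vv vec_eq_iff field_simps)
    then show ?thesis by blast
  qed
  obtain bu a where u': "(u - bu *s e) \<odot> (u - bu *s e) = a *s e" using shift[OF det] by blast
  have "det3 e w u \<noteq> 0" using det by (simp add: det3_def algebra_simps)
  then obtain bw a' where w': "(w - bw *s e) \<odot> (w - bw *s e) = a' *s e" using shift by blast
  define U where "U = u - bu *s e"
  define W where "W = w - bw *s e"
  have "det3 e U W = det3 e u w" by (simp add: U_def W_def det3_def algebra_simps)
  then have detUW: "det3 e U W \<noteq> 0" using det by simp
  have UU: "U \<odot> U = a *s e" and WW: "W \<odot> W = a' *s e" using u' w' by (simp_all add: U_def W_def)
  have "det3 e (U + W) W = det3 e U W" "det3 e (U - W) W = det3 e U W"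
    by (simp_all add: det3_def algebra_simps)
  then obtain p q p' q' where
    p: "(U + W) \<odot> (U + W) = p *s e + q *s (U + W)" and p': "(U - W) \<odot> (U - W) = p' *s e + q' *s (U - W)"
    using det3_zero_third[OF _ nm] detUW by metis
  have s: "a *s e + 2 *s (U \<odot> W) + a' *s e = p *s e + q *s (U + W)"
    using p by (simp add: bil_simps UU WW comm[of W U] vec_eq_iff algebra_simps)
  have s': "a *s e - 2 *s (U \<odot> W) + a' *s e = p' *s e + q' *s (U - W)"
    using p' by (simp add: bil_simps UU WW comm[of W U] vec_eq_iff algebra_simps)
  have "(p + p' - 2 * a - 2 * a') *s e + (q + q') *s U + (q - q') *s W
     = (p *s e + q *s (U + W) - (a *s e + 2 *s (U \<odot> W) + a' *s e))
     + (p' *s e + q' *s (U - W) - (a *s e - 2 *s (U \<odot> W) + a' *s e))"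
    by (simp add: vec_eq_iff algebra_simps)
  also have "\<dots> = 0" unfolding s s' by simp
  finally have "q + q' = 0" "q - q' = 0" using det3_eq_0[OF detUW] by blast+
  then have q: "q = 0" by (metis add_cancel_right_left eq_iff_diff_eq_0 mult_2 mult_eq_0_iff zero_neq_numeral)
  define r where "r = (p - a - a') / 2"
  have UW: "U \<odot> W = r *s e" using s unfolding q r_def by (simp add: vec_eq_iff field_simps)
  have "0 *s e + (- r) *s U + a *s W = 0" using assoc[of U U W]
    by (simp add: UU UW bil_simps unit unit' vec_eq_iff)
  then have a: "a = 0" "r = 0" using det3_eq_0[OF detUW] by fastforce+
  have "0 *s e + a' *s U + (- r) *s W = 0" using assoc[of U W W]
    by (simp add: WW UW bil_simps unit unit' vec_eq_iff)
  then have a': "a' = 0" using det3_eq_0[OF detUW] by blast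
  have sq: "U \<odot> U = 0" "U \<odot> W = 0" "W \<odot> W = 0" by (simp_all add: UU UW WW a a')
  obtain k0 k1 k2 where k: "bk U W = k0 *s e + k1 *s U + k2 *s W" using det3_span[OF detUW] .
  have "0 *s e + (2 * k0) *s U + 0 *s W = bk (U \<odot> U) W"
    unfolding leibniz k by (simp add: bil_simps unit unit' sq comm[of W U] vec_eq_iff)
  then have k0: "k0 = 0" using det3_eq_0[OF detUW, of 0 "2 * k0" 0] by (simp add: sq)
  have "c \<in> orbit (mkstr [(0,0,0,1), (0,1,1,1), (0,2,2,1)] [(1,2,1,k1), (1,2,2,k2)])"
    by (rule table_orbit[OF detUW]) (simp_all add: symtab_def asymtab_def unit sq central k k0)
  then show ?thesis using zclosure_U_orbit(5) in_zclosure_U18 by blast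
qed

text \<open>\<open>u\<close> and \<open>w\<close> lie in different eigenspaces of multiplication by
  \<open>e\<close>. Since \<open>e\<close> is central, Leibniz places \<open>{u,w}\<close> in both
  eigenspaces, so it is zero.\<close>

lemma idempotent_rank_two:
  assumes det: "det3 e u w \<noteq> 0" and e: "e \<odot> e = e" "e \<odot> u = u" "e \<odot> w = 0"
    and central: "\<And>x. bk e x = 0"
  shows "c \<in> zclosure U7"
proof -
  have "e \<odot> bk u w = bk u w" using leibniz[of e u w] by (simp add: e central)
  moreover have "e \<odot> bk w u = 0" using leibniz[of e w u] by (simp add: e central)
  ultimately have k: "bk u w = 0" using anti[of u w] by (simp add: bil_simps)
  have uw: "u \<odot> w = 0" using assoc[of u e w] by (simp add: e comm[of u e])
  obtain a b d where uu: "u \<odot> u = a *s e + b *s u + d *s w" using det3_span[OF det] .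
  have "e \<odot> (u \<odot> u) = u \<odot> u" using assoc[of e u u] by (simp add: e)
  then have "0 *s e + 0 *s u + d *s w = 0" unfolding uu by (simp add: bil_simps e)
  then have d: "d = 0" using det3_eq_0[OF det] by blast
  obtain a' b' d' where ww: "w \<odot> w = a' *s e + b' *s u + d' *s w" using det3_span[OF det] .
  have "e \<odot> (w \<odot> w) = 0" using assoc[of e w w] by (simp add: e)
  then have "a' *s e + b' *s u + 0 *s w = 0" unfolding ww by (simp add: bil_simps e)
  then have d': "a' = 0" "b' = 0" using det3_eq_0[OF det] by blast+
  \<comment> \<open>Then \<open>(u - r e) (u - r' e) = 0\<close>, so \<open>U = u - r e\<close>
    satisfies \<open>U U = (r' - r) U\<close>.\<close>
  obtain r r' where r: "r + r' = b" "r * r' = - a" by (rule quadratic_roots)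
  define U where "U = u - r *s e"
  have "det3 e U w = det3 e u w" by (simp add: U_def det3_def algebra_simps)
  then have detU: "det3 e U w \<noteq> 0" using det by simp
  have a: "a = - (r * r')" using r by simp
  have "c \<in> orbit (mkstr [(0,0,0,1), (0,1,1,1), (1,1,1,r' - r), (2,2,2,d')] [])"
    by (rule table_orbit[OF detU])
      (simp_all add: symtab_def asymtab_def U_def bil_simps e uw uu ww d d' central k comm[of u e]
        a r(1)[symmetric] vec_eq_iff algebra_simps)
  then show ?thesis using zclosure_U_orbit(3) decomposable_in_zclosure_U7 by blast
qed

text \<open>In the annihilator of \<open>e\<close> every square is parallel to its element, since
  otherwise \<open>l e + v\<close> would be a generator; thus \<open>square_zero_pair\<close>
  applies there.\<close>

lemma idempotent_rank_one:
  assumes det: "det3 e u w \<noteq> 0" and e: "e \<odot> e = e" "e \<odot> u = 0" "e \<odot> w = 0"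
    and central: "\<And>x. bk e x = 0"
  shows "c \<in> zclosure U20"
proof -
  have par: "\<exists>a. v \<odot> v = a *s v" if ev: "e \<odot> v = 0" "v \<noteq> 0" for v
  proof (rule ccontr)
    assume np: "\<not> (\<exists>a. v \<odot> v = a *s v)"
    then obtain z where dz: "det3 v (v \<odot> v) z \<noteq> 0"
      using det3_zero_imp_dependent[OF ev(2), of "v \<odot> v"] by blast
    have ve: "v \<odot> e = 0" by (simp add: comm[of v e] ev)
    have evv: "e \<odot> (v \<odot> v) = 0" using assoc[of e v v] by (simp add: ev)
    then have vve: "v \<odot> v \<odot> e = 0" by (simp add: comm[of _ e])
    have "det3 v (v \<odot> v) e \<noteq> 0"
    proof
      assume "det3 v (v \<odot> v) e = 0"
      then obtain a b where "e = a *s v + b *s (v \<odot> v)" using det3_zero_third[OF dz] by blast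
      then have "e \<odot> e = e \<odot> (a *s v + b *s (v \<odot> v))" by simp
      then have "e = 0" by (simp add: bil_simps ev evv e)
      then show False using det by (simp add: det3_def)
    qed
    then have d: "det3 e v (v \<odot> v) \<noteq> 0" by (simp add: det3_def algebra_simps)
    obtain a b g where y3: "v \<odot> (v \<odot> v) = a *s e + b *s v + g *s (v \<odot> v)" using det3_span[OF d] .
    have "e \<odot> (v \<odot> (v \<odot> v)) = 0" using assoc[of e v "v \<odot> v"] by (simp add: ev)
    then have "a *s e + 0 *s v + 0 *s (v \<odot> v) = 0" unfolding y3 by (simp add: bil_simps e ev evv)
    then have a: "a = 0" using det3_eq_0[OF d] by blast
    \<comment> \<open>\<open>l\<close> must avoid the roots of \<open>X^3 - g X^2 - b X\<close>, the
      relation satisfied by \<open>v\<close>.\<close>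
    obtain l where l: "l * l * l + (- g) * (l * l) + (- b) * l + 0 \<noteq> 0" by (rule cubic_nonroot)
    define x where "x = l *s e + 1 *s v + 0 *s (v \<odot> v)"
    have xx: "x \<odot> x = (l * l) *s e + 0 *s v + 1 *s (v \<odot> v)"
      by (simp add: x_def bil_simps e ev ve evv)
    have xxx: "x \<odot> (x \<odot> x) = (l * l * l) *s e + b *s v + g *s (v \<odot> v)"
      unfolding xx by (simp add: x_def bil_simps e ev ve evv y3 a algebra_simps)
    have "det3 x (x \<odot> x) (x \<odot> (x \<odot> x)) = (l * l * l + (- g) * (l * l) + (- b) * l + 0) * det3 e v (v \<odot> v)"
      by (subst xxx, subst xx, subst x_def, subst det3_lincomb) (simp add: algebra_simps)
    then show False using nonmonogenic d l by simp
  qed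
  have ind: "a = 0 \<and> b = 0" if "a *s u + b *s w = 0" for a b
    using det3_eq_0[OF det, of 0 a b] that by simp
  have "u \<noteq> 0" "w \<noteq> 0" "u + w \<noteq> 0" "u - w \<noteq> 0"
    using ind[of 1 0] ind[of 0 1] ind[of 1 1] ind[of 1 "-1"] by (auto simp: vector_smult_lneg)
  then obtain l m p q where "u \<odot> u = l *s u" "w \<odot> w = m *s w" "(u + w) \<odot> (u + w) = p *s (u + w)"
      "(u - w) \<odot> (u - w) = q *s (u - w)"
    using par[of u] par[of w] par[of "u + w"] par[of "u - w"] e by (auto simp: bil_simps)
  from square_zero_pair[OF ind this] have sq: "u \<odot> u = 0" "u \<odot> w = 0" "w \<odot> w = 0" by auto
  obtain k0 k1 k2 where k: "bk u w = k0 *s e + k1 *s u + k2 *s w" using det3_span[OF det] .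
  have "e \<odot> bk u w = 0" using leibniz[of e u w] by (simp add: e central)
  then have "k0 *s e + 0 *s u + 0 *s w = 0" unfolding k by (simp add: bil_simps e)
  then have k0: "k0 = 0" using det3_eq_0[OF det] by blast
  have "c \<in> orbit (mkstr [(0,0,0,1)] [(1,2,1,k1), (1,2,2,k2)])"
    by (rule table_orbit[OF det]) (simp_all add: symtab_def asymtab_def e sq central k k0)
  then show ?thesis using zclosure_U_orbit(6) in_zclosure_U20 by blast
qed

lemma idempotent_case:
  assumes e: "e \<odot> e = e" "e \<noteq> 0"
  shows "c \<in> zclosure U7 \<union> zclosure U18 \<union> zclosure U20"
proof -
  have central: "bk e x = 0" for x
  proof -
    \<comment> \<open>Leibniz on \<open>e e = e\<close> gives \<open>{e,x} = 2 k\<close>;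
      multiplying by \<open>e\<close> gives \<open>k = 2 k\<close>.\<close>
    define k where "k = e \<odot> bk e x"
    have 1: "bk e x = 2 *s k"
      using leibniz[of e e x] unfolding e(1) comm[of "bk e x" e] k_def by (simp add: vec_eq_iff)
    have "k = e \<odot> (2 *s k)" unfolding 1[symmetric] by (rule k_def)
    also have "\<dots> = 2 *s k"
      using assoc[of e e "bk e x"] unfolding e(1) by (simp add: bil_simps k_def)
    finally have "k = 0" by (simp add: vec_eq_iff)
    then show ?thesis using 1 by simp
  qed
  obtain y z where det: "det3 e y z \<noteq> 0" using det3_extend[OF e(2)] .
  define P where "P = (\<lambda>v. e \<odot> v)"
  define R where "R = (\<lambda>v. v - e \<odot> v)"
  have P: "e \<odot> P v = P v" and R: "e \<odot> R v = 0" for v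
    using assoc[of e e v] by (simp_all add: P_def R_def bil_simps e)
  \<comment> \<open>The Peirce decomposition \<open>v = P v + R v\<close> expands the determinant; a
    nonzero summand provides an eigenbasis of multiplication by \<open>e\<close>, which then has
    rank 3, 2 or 1.\<close>
  have "det3 e y z = det3 e (P y) (P z) + det3 e (P y) (R z) - det3 e (P z) (R y) + det3 e (R y) (R z)"
    unfolding P_def R_def det3_def vector_minus_component by (simp add: algebra_simps)
  then consider "det3 e (P y) (P z) \<noteq> 0" | v v' where "det3 e (P v) (R v') \<noteq> 0" | "det3 e (R y) (R z) \<noteq> 0"
    using det by fastforce
  then show ?thesis
  proof cases
    case 1
    have "e \<odot> v = v" for v
    proof -
      obtain a b g where v: "v = a *s e + b *s P y + g *s P z" using det3_span[OF 1] .
      show ?thesis unfolding v by (simp add: bil_simps e P)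
    qed
    then show ?thesis using idempotent_unit[OF 1 _ central] by blast
  next
    case 2
    then show ?thesis using idempotent_rank_two[OF 2 e(1) P R central] by blast
  next
    case 3
    then show ?thesis using idempotent_rank_one[OF 3 e(1) R R central] by blast
  qed
qed

end

lemma nilpotent_case:
  assumes det: "det3 x (x \<odot> x) z \<noteq> 0" and cube: "x \<odot> (x \<odot> x) = 0"
    and no_idem: "\<And>e. e \<odot> e = e \<Longrightarrow> e = 0"
  shows "c \<in> zclosure U16 \<union> zclosure U20"
proof -
  define v where "v = x \<odot> x"
  have xx: "x \<odot> x = v" and xv: "x \<odot> v = 0" and det: "det3 x v z \<noteq> 0"
    using cube det by (simp_all add: v_def)
  have vx: "v \<odot> x = 0" using comm[of v x] xv by simp
  have vv: "v \<odot> v = 0" using assoc[of x x v] by (simp add: xx xv)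
  obtain a b g where xz0: "x \<odot> z = a *s x + b *s v + g *s z" using det3_span[OF det] .
  have "x \<odot> (x \<odot> z) = x \<odot> (a *s x + b *s v + g *s z)" by (simp only: xz0)
  also have "\<dots> = a *s v + g *s (x \<odot> z)" by (simp add: bil_simps xx xv)
  finally have xxz: "x \<odot> (x \<odot> z) = a *s v + g *s (x \<odot> z)" .
  have vz0: "v \<odot> z = a *s v + g *s (x \<odot> z)"
    using assoc[of x x z] unfolding xx xxz .
  \<comment> \<open>Multiplication by \<open>x\<close> has cube zero, and \<open>g\<close> is its
    eigenvalue modulo the span of \<open>x\<close> and \<open>v\<close>; hence
    \<open>g^3 = 0\<close>.\<close>
  have "0 = x \<odot> (v \<odot> z)" using assoc[of x v z] by (simp add: xv)
  also have "\<dots> = g *s (x \<odot> (x \<odot> z))" unfolding vz0 by (simp add: bil_simps xv)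
  also note xxz
  finally have "0 = g *s (a *s v + g *s (x \<odot> z))" .
  also have "\<dots> = (g * g * a) *s x + (g * a + g * g * b) *s v + (g * g * g) *s z"
    unfolding xz0 by (simp add: vec_eq_iff algebra_simps)
  finally have "(g * g * a) *s x + (g * a + g * g * b) *s v + (g * g * g) *s z = 0" by (rule sym)
  then have "g * g * g = 0" using det3_eq_0[OF det] by blast
  then have g: "g = 0" by simp
  define Z where "Z = z - b *s x"
  have "det3 x v Z = det3 x v z" by (simp add: Z_def det3_def algebra_simps)
  then have detZ: "det3 x v Z \<noteq> 0" using det by simp
  have xZ: "x \<odot> Z = a *s x" by (simp add: Z_def bil_simps xz0 g xx)
  have vZ: "v \<odot> Z = a *s v" by (simp add: Z_def bil_simps vz0 g vx)
  have Zx: "Z \<odot> x = a *s x" and Zv: "Z \<odot> v = a *s v"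
    using xZ vZ comm[of Z x] comm[of Z v] by simp_all
  obtain p q r where ZZ0: "Z \<odot> Z = p *s x + q *s v + r *s Z" using det3_span[OF detZ] .
  have "x \<odot> (Z \<odot> Z) = (a * a) *s x" using assoc[of x Z Z] by (simp add: xZ bil_simps)
  moreover have "x \<odot> (Z \<odot> Z) = p *s v + (r * a) *s x"
    unfolding ZZ0 by (simp add: bil_simps xx xv xZ)
  ultimately have "(r * a - a * a) *s x + p *s v + 0 *s Z = 0"
    by (simp add: vec_eq_iff algebra_simps)
  then have pr: "p = 0" "r * a = a * a" using det3_eq_0[OF detZ] by (blast, fastforce)
  have ZZ: "Z \<odot> Z = q *s v + r *s Z" using ZZ0 pr by simp
  have a: "a = 0"
  proof (rule ccontr)
    assume a: "a \<noteq> 0"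
    then have r: "r = a" using pr by simp
    \<comment> \<open>Here \<open>Z Z = q v + a Z\<close> and \<open>v Z = a v\<close>; the
      \<open>v\<close>-term corrects \<open>Z / a\<close> to an idempotent.\<close>
    define e where "e = 0 *s x + (- q / (a * a)) *s v + (1 / a) *s Z"
    have "e \<odot> e = e"
      using a by (simp add: e_def bil_simps ZZ vZ Zv vv r vec_eq_iff field_simps)
    then have "e = 0" by (rule no_idem)
    then show False using det3_eq_0[OF detZ] a unfolding e_def by fastforce
  qed
  have r: "r = 0"
  proof (rule ccontr)
    assume r: "r \<noteq> 0"
    \<comment> \<open>Now \<open>v Z = 0\<close>, so the correction of \<open>Z / r\<close> has the
      opposite sign.\<close>
    define e where "e = 0 *s x + (q / (r * r)) *s v + (1 / r) *s Z"
    have "e \<odot> e = e"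
      using r by (simp add: e_def bil_simps ZZ vZ Zv vv a vec_eq_iff field_simps)
    then have "e = 0" by (rule no_idem)
    then show False using det3_eq_0[OF detZ] r unfolding e_def by fastforce
  qed
  have xZ: "x \<odot> Z = 0" and vZ: "v \<odot> Z = 0" and ZZ: "Z \<odot> Z = q *s v"
    using xZ vZ ZZ a r by simp_all
  obtain k0 k1 k2 where k: "bk x Z = k0 *s x + k1 *s v + k2 *s Z" using det3_span[OF detZ] .
  have "bk (x \<odot> Z) x = x \<odot> bk Z x" using leibniz[of x Z x] by simp
  then have "x \<odot> bk x Z = 0" using anti[of Z x] by (simp add: xZ bil_simps)
  then have "0 *s x + k0 *s v + 0 *s Z = 0" unfolding k by (simp add: bil_simps xx xv xZ)
  then have k0: "k0 = 0" using det3_eq_0[OF detZ] by blast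
  have k: "bk x Z = k1 *s v + k2 *s Z" using k k0 by simp
  have vk: "bk v x = 0" using leibniz[of x x x] by (simp add: xx)
  then have xvb: "bk x v = 0" using anti[of x v] by simp
  have "bk v Z = bk x Z \<odot> x + x \<odot> bk x Z" using leibniz[of x x Z] by (simp add: xx)
  then have vZb: "bk v Z = 0" unfolding comm[of _ x] unfolding k by (simp add: bil_simps xv xZ)
  have "bk x Z \<odot> Z = 0" using leibniz[of x Z Z] by (simp add: xZ)
  then have "0 *s x + (k2 * q) *s v + 0 *s Z = 0" unfolding k by (simp add: bil_simps vZ ZZ)
  then have k2q: "k2 * q = 0" using det3_eq_0[OF detZ] by blast
  show ?thesis
  proof (cases "k2 = 0")
    case True
    have "c \<in> orbit (mkstr [(0,0,1,1), (2,2,1,q)] [(0,2,1,k1)])"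
      by (rule table_orbit[OF detZ])
        (simp_all add: symtab_def asymtab_def xx xv xZ vv vZ ZZ xvb vZb k True)
    then show ?thesis using zclosure_U_orbit(4) in_zclosure_U16 by blast
  next
    case False
    then have q: "q = 0" using k2q by simp
    \<comment> \<open>Since \<open>{x,v} = 0\<close>, this is an eigenvector:
      \<open>{x,Y} = k2 Y\<close>.\<close>
    define Y where "Y = Z + (k1 / k2) *s v"
    have "det3 x v Y = det3 x v Z" by (simp add: Y_def det3_def algebra_simps)
    then have detY: "det3 x v Y \<noteq> 0" using detZ by simp
    have "c \<in> orbit (mkstr [(0,0,1,1)] [(0,2,2,k2)])"
      by (rule table_orbit[OF detY])
        (use False in \<open>simp_all add: symtab_def asymtab_def Y_def bil_simps xx xv xZ vv vZ comm[of Z v]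
          ZZ xvb vZb k q vec_eq_iff field_simps\<close>)
    then show ?thesis using zclosure_U_orbit(6) nilpotent_in_zclosure_U20[OF False] by blast
  qed
qed

lemma product_nonzero_case:
  assumes "x \<odot> y \<noteq> 0"
  shows "c \<in> zclosure U7 \<union> zclosure U16 \<union> zclosure U18 \<union> zclosure U20"
proof (cases "\<exists>x. det3 x (x \<odot> x) (x \<odot> (x \<odot> x)) \<noteq> 0")
  case True
  then show ?thesis using monogenic by blast
next
  case False
  then have nm: "det3 x (x \<odot> x) (x \<odot> (x \<odot> x)) = 0" for x by blast
  show ?thesis
  proof (cases "\<exists>e. e \<odot> e = e \<and> e \<noteq> 0")
    case True
    then show ?thesis using idempotent_case[OF nm] by blast
  next
    case no_idem: False
    obtain x where x: "\<nexists>a. x \<odot> x = a *s x" using mul_zero_if_squares_parallel assms by blast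
    then have "x \<noteq> 0" by auto
    then obtain z where z: "det3 x (x \<odot> x) z \<noteq> 0" using det3_zero_imp_dependent x by blast
    obtain b a where cube: "x \<odot> (x \<odot> x) = b *s x + a *s (x \<odot> x)" using det3_zero_third[OF z nm] .
    have b: "b = 0"
    proof (rule ccontr)
      assume b: "b \<noteq> 0"
      \<comment> \<open>Solving \<open>x^3 = b x + a x^2\<close> for \<open>x\<close> shows that
        \<open>e x = x\<close>; as \<open>e\<close> is a polynomial in \<open>x\<close> without
        constant term, \<open>e e = e\<close>.\<close>
      define e where "e = (1 / b) *s (x \<odot> x) - (a / b) *s x"
      have ex: "e \<odot> x = x"
        using b by (simp add: e_def bil_simps comm[of "x \<odot> x" x] cube vec_eq_iff field_simps)
      then have "e \<odot> (x \<odot> x) = x \<odot> x" using assoc[of e x x] by simp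
      then have "e \<odot> e = e" by (subst (2) e_def) (simp add: bil_simps ex, simp add: e_def)
      then have "e = 0" using no_idem by blast
      then show False using ex \<open>x \<noteq> 0\<close> by simp
    qed
    have a: "a = 0"
    proof (rule ccontr)
      assume a: "a \<noteq> 0"
      \<comment> \<open>With \<open>b = 0\<close> this reads \<open>x^4 = a^2 x^2\<close>, so
        \<open>x^2 / a^2\<close> is idempotent.\<close>
      have "x \<odot> x \<odot> (x \<odot> x) = (a * a) *s (x \<odot> x)"
        using assoc[of x x "x \<odot> x"] by (simp add: cube b bil_simps)
      then have "(1 / (a * a)) *s (x \<odot> x) \<odot> ((1 / (a * a)) *s (x \<odot> x)) = (1 / (a * a)) *s (x \<odot> x)"
        using a by (simp add: bil_simps vec_eq_iff)
      then have "(1 / (a * a)) *s (x \<odot> x) = 0" using no_idem by blast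
      then have "x \<odot> x = 0 *s x" using a by (simp add: vec_eq_iff)
      then show False using x by blast
    qed
    have "x \<odot> (x \<odot> x) = 0" using cube a b by simp
    then show ?thesis using nilpotent_case[OF z] no_idem by blast
  qed
qed

text \<open>\<open>(f0, f1, f2)\<close> is the covector \<open>tr ad\<close>, and Jacobi says
  \<open>f0 {y,z} + f1 {z,x} + f2 {x,y} = 0\<close>. Since \<open>f0 \<noteq> 0\<close>, the vectors
  \<open>u\<close>, \<open>w\<close> span its kernel with \<open>x\<close> outside, and Jacobi
  becomes \<open>{u,w} = 0\<close>.\<close>

lemma lie_nonunimodular:
  assumes mul0: "\<And>x y. x \<odot> y = 0" and det: "det3 x y z \<noteq> 0"
    and C: "bk x y = C0 *s x + C1 *s y + C2 *s z"
    and B: "bk z x = B0 *s x + B1 *s y + B2 *s z"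
    and A: "bk y z = A0 *s x + A1 *s y + A2 *s z"
    and f0: "C1 \<noteq> B2"
  shows "c \<in> zclosure U4"
proof -
  define f0 where "f0 = C1 - B2"
  define f1 where "f1 = A2 - C0"
  define f2 where "f2 = B0 - A1"
  have f0_ne: "f0 \<noteq> 0" using f0 by (simp add: f0_def)
  have yx: "bk y x = - bk x y" and xz: "bk x z = - bk z x" and zy: "bk z y = - bk y z"
    by (rule anti)+
  have "bk x (bk y z) + bk y (bk z x) + bk z (bk x y) =
      (- (f0 * A0 + f1 * B0 + f2 * C0)) *s x + (- (f0 * A1 + f1 * B1 + f2 * C1)) *s y
      + (- (f0 * A2 + f1 * B2 + f2 * C2)) *s z"
    unfolding A B C bil_simps alt yx xz zy unfolding A B C f0_def f1_def f2_def
    by (simp add: vec_eq_iff algebra_simps)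
  then have "(- (f0 * A0 + f1 * B0 + f2 * C0)) *s x + (- (f0 * A1 + f1 * B1 + f2 * C1)) *s y
      + (- (f0 * A2 + f1 * B2 + f2 * C2)) *s z = 0" unfolding jacobi by (rule sym)
  from det3_eq_0[OF det this] have J: "f0 * A0 + f1 * B0 + f2 * C0 = 0"
    "f0 * A1 + f1 * B1 + f2 * C1 = 0" "f0 * A2 + f1 * B2 + f2 * C2 = 0"
    unfolding neg_equal_0_iff_equal by blast+
  define n1 where "n1 = f1 / f0"
  define n2 where "n2 = f2 / f0"
  define u where "u = y - n1 *s x"
  define w where "w = z - n2 *s x"
  have solve: "r = - (n1 * p + n2 * q)" if "f0 * r + f1 * p + f2 * q = 0" for r p q
  proof -
    have "f0 * (r + (n1 * p + n2 * q)) = f0 * r + f1 * p + f2 * q"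
      using f0_ne by (simp add: n1_def n2_def algebra_simps)
    then have "r + (n1 * p + n2 * q) = 0" using that f0_ne by simp
    then show ?thesis by (rule add_eq_0_iff2[THEN iffD1])
  qed
  \<comment> \<open>The left sides are the traces of \<open>ad {x,y}\<close> and
    \<open>ad {z,x}\<close>; as they vanish, \<open>ad x\<close> maps into the kernel.\<close>
  have "f0 * C0 + f1 * C1 + f2 * C2 = f0 * A2 + f1 * B2 + f2 * C2"
    "f0 * B0 + f1 * B1 + f2 * B2 = f0 * A1 + f1 * B1 + f2 * C1"
    by (simp_all add: f0_def f1_def f2_def algebra_simps)
  then have CB: "C0 = - (n1 * C1 + n2 * C2)" "B0 = - (n1 * B1 + n2 * B2)"
    using solve J(2,3) by metis+
  note A' = J[THEN solve]
  have "det3 x u w = det3 x y z" by (simp add: u_def w_def det3_def algebra_simps)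
  then have detu: "det3 x u w \<noteq> 0" using det by simp
  have xu: "bk x u = C1 *s u + C2 *s w"
    unfolding u_def w_def bil_simps alt C CB(1) by (simp add: vec_eq_iff algebra_simps)
  have xw: "bk x w = (- B1) *s u + (- B2) *s w"
    unfolding u_def w_def bil_simps alt xz B CB(2) by (simp add: vec_eq_iff algebra_simps)
  have uw: "bk u w = 0"
    unfolding u_def w_def bil_simps alt xz yx A B C A' by (simp add: vec_eq_iff algebra_simps)
  show ?thesis
  proof (cases "C2 = 0")
    case True
    have "c \<in> orbit (mkstr [] [(0,1,1,C1), (0,2,2,- B2), (0,2,1,- B1)])"
      by (rule table_orbit[OF detu])
        (simp_all add: symtab_def asymtab_def mul0 xu xw uw True vec_eq_iff)
    then show ?thesis using zclosure_U_orbit(1) in_zclosure_U4 by blast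
  next
    case False
    obtain l l' where l: "l + l' = C1 + (- B2)" "l * l' = C1 * (- B2) - C2 * (- B1)"
      by (rule quadratic_roots)
    \<comment> \<open>\<open>t = (ad x - l') u\<close>, so Cayley-Hamilton gives
      \<open>{x,t} = l t\<close>, and \<open>t\<close>, \<open>u\<close> triangularise
      \<open>ad x\<close>.\<close>
    define t where "t = (C1 - l') *s u + C2 *s w"
    have "det3 x t u = - C2 * det3 x u w" by (simp add: t_def det3_def algebra_simps)
    then have dett: "det3 x t u \<noteq> 0" using detu False by simp
    have B2: "B2 = C1 - l - l'" using l(1) by (simp add: algebra_simps)
    have "C2 * B1 = l * l' + C1 * B2" using l(2) by (simp add: algebra_simps)
    then have C2B1: "C2 * B1 = l * l' + C1 * (C1 - l - l')" by (simp only: B2)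
    have coeff: "(C1 - l') * C1 - C2 * B1 = l * (C1 - l')" "(C1 - l') * C2 - C2 * B2 = l * C2"
      unfolding C2B1 B2 by (simp_all add: algebra_simps)
    have "bk x t = ((C1 - l') * C1 - C2 * B1) *s u + ((C1 - l') * C2 - C2 * B2) *s w"
      unfolding t_def bil_simps xu xw by (simp add: vec_eq_iff algebra_simps)
    then have xt: "bk x t = l *s t" unfolding coeff t_def by (simp add: vec_eq_iff algebra_simps)
    have xu': "bk x u = l' *s u + 1 *s t" unfolding xu t_def by (simp add: vec_eq_iff algebra_simps)
    have tu: "bk t u = 0" unfolding t_def bil_simps anti[of w u] uw by simp
    have "c \<in> orbit (mkstr [] [(0,1,1,l), (0,2,2,l'), (0,2,1,1)])"
      by (rule table_orbit[OF dett])
        (simp_all add: symtab_def asymtab_def mul0 xt xu' tu add.commute)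
    then show ?thesis using zclosure_U_orbit(1) in_zclosure_U4 by blast
  qed
qed

lemma product_zero_case:
  assumes mul0: "\<And>x y. x \<odot> y = 0"
  shows "c \<in> zclosure U4 \<union> zclosure U5"
proof -
  define x :: "complex^3" where "x = vec3 1 0 0"
  define y :: "complex^3" where "y = vec3 0 1 0"
  define z :: "complex^3" where "z = vec3 0 0 1"
  have det: "det3 x y z \<noteq> 0" "det3 y z x \<noteq> 0" "det3 z x y \<noteq> 0"
    by (simp_all add: x_def y_def z_def det3_def)
  obtain C0 C1 C2 where C: "bk x y = C0 *s x + C1 *s y + C2 *s z" using det3_span[OF det(1)] .
  obtain B0 B1 B2 where B: "bk z x = B0 *s x + B1 *s y + B2 *s z" using det3_span[OF det(1)] .
  obtain A0 A1 A2 where A: "bk y z = A0 *s x + A1 *s y + A2 *s z" using det3_span[OF det(1)] .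
  \<comment> \<open>The three components of \<open>tr ad\<close> are permuted cyclically with
    \<open>x\<close>, \<open>y\<close>, \<open>z\<close>, so one lemma serves all three.\<close>
  have rot: "a *s x + b *s y + d *s z = b *s y + d *s z + a *s x"
    "a *s x + b *s y + d *s z = d *s z + a *s x + b *s y" for a b d
    by (simp_all add: add_ac)
  consider "C1 \<noteq> B2" | "A2 \<noteq> C0" | "B0 \<noteq> A1" | "C1 = B2" "A2 = C0" "B0 = A1" by blast
  then show ?thesis
  proof cases
    case 1
    then show ?thesis using lie_nonunimodular[OF mul0 det(1) C B A] by blast
  next
    case 2
    then show ?thesis
      using lie_nonunimodular[OF mul0 det(2) A[unfolded rot(1)] C[unfolded rot(1)] B[unfolded rot(1)]]
      by blast
  next
    case 3
    then show ?thesis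
      using lie_nonunimodular[OF mul0 det(3) B[unfolded rot(2)] A[unfolded rot(2)] C[unfolded rot(2)]]
      by blast
  next
    case 4
    \<comment> \<open>Vanishing of \<open>tr ad\<close> is the symmetry of the matrix with rows
      \<open>A\<close>, \<open>B\<close>, \<open>C\<close>.\<close>
    have "c \<in> orbit (sym_structure A0 A1 A2 B1 B2 C2)"
      unfolding sym_structure_def
      by (rule table_orbit[OF det(1)])
        (simp_all add: symtab_def asymtab_def mul0 C A 4 anti[of x z] B vec_eq_iff)
    then show ?thesis using zclosure_U_orbit(2) sym_structure_in_zclosure_U5 by blast
  qed
qed

end

lemma P3_subset_zclosures:
  "P3 \<subseteq> zclosure U5 \<union> zclosure U7 \<union> zclosure U18 \<union> zclosure U20 \<union> zclosure U4 \<union> zclosure U16"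
proof
  fix c assume "c \<in> P3"
  then interpret poisson_algebra c by unfold_locales (simp add: P3_def)
  show "c \<in> zclosure U5 \<union> zclosure U7 \<union> zclosure U18 \<union> zclosure U20 \<union> zclosure U4 \<union> zclosure U16"
    using product_zero_case product_nonzero_case by blast
qed

theorem theorem4p10:
  shows "card (irreducible_components P3) = 6 \<and>
    irreducible_components P3 =
      {zclosure (orbit P3_5), zclosure (orbit P3_7), zclosure (orbit P3_18),
       zclosure (orbit P3_20),
       zclosure (\<Union>\<alpha>. orbit (P3_4 \<alpha>)), zclosure (\<Union>\<alpha>. orbit (P3_16 \<alpha>))}"
proof -
  let ?F = "{zclosure U5, zclosure U7, zclosure U18, zclosure U20, zclosure U4, zclosure U16}"
  have "irreducible_components P3 = ?F"
  proof (rule irreducible_components_eq)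
    show "finite ?F" by simp
    show "zclosed C" if "C \<in> ?F" for C using that zclosed_zclosure by blast
    show "zirreducible C" if "C \<in> ?F" for C using that zirreducible_zclosures by blast
    show "\<Union>?F = P3"
      using P3_subset_zclosures zclosures_subset_P3 by (simp add: Un_assoc subset_antisym)
    show "C = D" if "C \<in> ?F" "D \<in> ?F" "C \<subseteq> D" for C D
      using that zclosures_incomparable by (elim insertE emptyE) simp_all
  qed
  moreover have "card ?F = 6"
  proof -
    have "zclosure U5 \<noteq> zclosure U7" "zclosure U5 \<noteq> zclosure U18" "zclosure U5 \<noteq> zclosure U20"
      "zclosure U5 \<noteq> zclosure U4" "zclosure U5 \<noteq> zclosure U16" "zclosure U7 \<noteq> zclosure U18"
      "zclosure U7 \<noteq> zclosure U20" "zclosure U7 \<noteq> zclosure U4" "zclosure U7 \<noteq> zclosure U16"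
      "zclosure U18 \<noteq> zclosure U20" "zclosure U18 \<noteq> zclosure U4" "zclosure U18 \<noteq> zclosure U16"
      "zclosure U20 \<noteq> zclosure U4" "zclosure U20 \<noteq> zclosure U16" "zclosure U4 \<noteq> zclosure U16"
      using zclosures_incomparable by (metis subset_refl)+
    then show ?thesis by simp
  qed
  ultimately show ?thesis unfolding U_defs by simp
qed

end
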